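(* Let $(V,E)$ be the graph of one of the Archimedean tilings $(4^4)$, $(3^6)$, $(6^3)$, $(3^3.4^2)$, $(4.8^2)$, $(3^2.4.3.4)$, $(3.4.6.4)$, $(4.6.12)$, $(3^4.6)$. Then there is no choice of periodic (with respect to the fundamental cell of the lattice) edge weights $\gamma_{vw}=\gamma_{wv}>0$ for which the weighted adjacency matrix $$\Pi_\gamma(v,w)=\begin{cases}\gamma_{vw} & \text{if } v\sim w,\\ 0 & \text{else}\end{cases}$$ (acting on $\ell^2(V)$) has a flat band. Consequently, also the Laplacian $\Delta_\gamma$ with constant or monomeric edge weights has no flat bands on these lattices.
   Context: An Archimedean tiling is an edge-to-edge tessellation of the Euclidean plane by regular convex polygons such that every vertex is surrounded by the same cyclic pattern of polygons. It is denoted by listing the numbers of sides of the polygons in cyclic order around a vertex, with powers for repetition (e.g. $(4.8^2)$ means a square and two octagons at each vertex). It is regarded as an infinite graph $G=(V,E)$ with $V$ the vertices and $E$ the edges of the tiling; $v\sim w$ means that $v$ and $w$ are joined by an edge. The group of translations preserving the tiling is isomorphic to $\mathbb{Z}^2$ and acts on $V$ by graph isomorphisms $T_\beta:V\to V$, $\beta\in\mathbb{Z}^2$; let $Q\subset V$ be a (finite) minimal fundamental domain of this action. Edge weights $\gamma_{vw}=\gamma_{wv}>0$ (for $v\sim w$) are periodic if $\gamma_{vw}=\gamma_{T_\beta v\,T_\beta w}$ for all $\beta\in\mathbb{Z}^2$. Flat bands: for $\theta\in\mathbb{R}^2$ let $\ell^2(V)_\theta=\{f:V\to\mathbb{C}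 : f(T_\beta v)=e^{i\langle\theta,\beta\rangle}f(v)\ \text{for all } v\in V,\ \beta\in\mathbb{Z}^2\}$, a $|Q|$-dimensional space with inner product $\langle f,g\rangle_\theta=\sum_{v\in Q}f(v)\overline{g(v)}$. A periodic operator of finite range on $\ell^2(V)$ acts on $\ell^2(V)_\theta$ by the same formula. A periodic self-adjoint operator (such as $\Pi_\gamma$ or $\Delta_\gamma$) has a flat band at energy $E\in\mathbb{R}$ if $E$ is an eigenvalue of its restriction to $\ell^2(V)_\theta$ for every $\theta$ (equivalently, there is an infinite orthonormal family of $\ell^2(V)$-eigenfunctions for the eigenvalue $E$). The edge weights are monomeric if for all $v\in V$ the list of edge weights, arranged cyclically around $v$, coincides up to cyclic permutations. For constant or monomeric weights the vertex weight $\mu=\sum_{w\sim v}\gamma_{vw}$ does not depend on $v$, and the Laplacian is $(\Delta_\gamma f)(v)=f(v)-\frac1\mu\sum_{w\sim v}\gamma_{vw}f(w)$. *)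

theory Defs
  imports "HOL-Analysis.Analysis"
begin

section \<open>Archimedean tilings of the Euclidean plane\<close>

text \<open>The plane is \<^typ>\<open>complex\<close>. A tile is a closed solid polygon, a tiling is its set of tiles.\<close>

definition regular_polygon :: "nat \<Rightarrow> complex set \<Rightarrow> bool" where
  "regular_polygon n P \<longleftrightarrow> n \<ge> 3 \<and>
     (\<exists>c r \<alpha>. r > 0 \<and>
        P = convex hull ((\<lambda>k. c + of_real r * cis (\<alpha> + 2 * pi * real k / real n)) ` {..<n}))"

definition tessellation :: "complex set set \<Rightarrow> bool" where
  "tessellation T \<longleftrightarrow>
     \<Union>T = UNIV \<and>
     (\<forall>P\<in>T. \<forall>Q\<in>T. P \<noteq> Q \<longrightarrow> interior P \<inter> interior Q = {}) \<and>
     (\<forall>K. bounded K \<longrightarrow> finite {P\<in>T. P \<inter> K \<noteq> {}})"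

text \<open>For polygons, a face shared by two distinct non-overlapping tiles is empty, a common vertex
  or a complete common edge.\<close>

definition edge_to_edge :: "complex set set \<Rightarrow> bool" where
  "edge_to_edge T \<longleftrightarrow>
     (\<forall>P\<in>T. \<forall>Q\<in>T. P \<noteq> Q \<longrightarrow> P \<inter> Q face_of P \<and> P \<inter> Q face_of Q)"

definition tiling_vertices :: "complex set set \<Rightarrow> complex set" where
  "tiling_vertices T = {v. \<exists>P\<in>T. v extreme_point_of P}"

definition tiling_adj :: "complex set set \<Rightarrow> complex \<Rightarrow> complex \<Rightarrow> bool" where
  "tiling_adj T v w \<longleftrightarrow> (\<exists>P\<in>T. closed_segment v w edge_of P)"

text \<open>The tiles at \<open>v\<close> can be enumerated, starting anywhere and in either direction of rotation,
  so that cyclically consecutive tiles share an edge at \<open>v\<close> and the numbers of sides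
  read \<open>cfg\<close>. Since either direction is allowed, the pattern may occur in mirrored form
  (as it does at half of the vertices of (4.6.12)).\<close>

definition vertex_pattern :: "complex set set \<Rightarrow> nat list \<Rightarrow> complex \<Rightarrow> bool" where
  "vertex_pattern T cfg v \<longleftrightarrow>
     (\<exists>Ps. distinct Ps \<and> set Ps = {P\<in>T. v \<in> P} \<and> list_all2 regular_polygon cfg Ps \<and>
        (\<forall>i<length Ps. \<exists>e. v \<in> e \<and> e edge_of (Ps ! i) \<and>
           e edge_of (Ps ! (Suc i mod length Ps))))"

definition archimedean_tiling :: "nat list \<Rightarrow> complex set set \<Rightarrow> bool" where
  "archimedean_tiling cfg T \<longleftrightarrow>
     tessellation T \<and> edge_to_edge T \<and> (\<forall>P\<in>T. \<exists>n. regular_polygon n P) \<and>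
     (\<forall>v\<in>tiling_vertices T. vertex_pattern T cfg v)"


section \<open>Translations\<close>

definition tiling_translations :: "complex set set \<Rightarrow> complex set" where
  "tiling_translations T = {t. (\<lambda>P. (\<lambda>x. x + t) ` P) ` T = T}"

definition lattice_vec :: "complex \<Rightarrow> complex \<Rightarrow> int \<times> int \<Rightarrow> complex" where
  "lattice_vec b1 b2 \<beta> = of_int (fst \<beta>) * b1 + of_int (snd \<beta>) * b2"

text \<open>Every group isomorphism from \<open>\<int>\<^sup>2\<close> onto the translation group has the form
  \<open>lattice_vec b1 b2\<close>; the action is then \<open>T\<^sub>\<beta> v = v + lattice_vec b1 b2 \<beta>\<close>.\<close>

definition lattice_basis :: "complex set set \<Rightarrow> complex \<Rightarrow> complex \<Rightarrow> bool" where
  "lattice_basis T b1 b2 \<longleftrightarrow> bij_betw (lattice_vec b1 b2) UNIV (tiling_translations T)"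

definition lattice_shift :: "complex \<Rightarrow> complex \<Rightarrow> int \<times> int \<Rightarrow> complex \<Rightarrow> complex" where
  "lattice_shift b1 b2 \<beta> v = v + lattice_vec b1 b2 \<beta>"


section \<open>Edge weights\<close>

text \<open>Only the values of \<open>\<gamma>\<close> on adjacent pairs matter.\<close>

definition edge_weights :: "complex set set \<Rightarrow> (complex \<Rightarrow> complex \<Rightarrow> real) \<Rightarrow> bool" where
  "edge_weights T \<gamma> \<longleftrightarrow> (\<forall>v w. tiling_adj T v w \<longrightarrow> \<gamma> v w = \<gamma> w v \<and> \<gamma> v w > 0)"

definition periodic_weights ::
  "complex set set \<Rightarrow> complex \<Rightarrow> complex \<Rightarrow> (complex \<Rightarrow> complex \<Rightarrow> real) \<Rightarrow> bool" where
  "periodic_weights T b1 b2 \<gamma> \<longleftrightarrow>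
     (\<forall>v w \<beta>. tiling_adj T v w \<longrightarrow>
        \<gamma> v w = \<gamma> (lattice_shift b1 b2 \<beta> v) (lattice_shift b1 b2 \<beta> w))"

definition constant_weights :: "complex set set \<Rightarrow> (complex \<Rightarrow> complex \<Rightarrow> real) \<Rightarrow> bool" where
  "constant_weights T \<gamma> \<longleftrightarrow> (\<exists>c. \<forall>v w. tiling_adj T v w \<longrightarrow> \<gamma> v w = c)"

definition ccw_neighbours :: "complex set set \<Rightarrow> complex \<Rightarrow> complex list \<Rightarrow> bool" where
  "ccw_neighbours T v ws \<longleftrightarrow>
     set ws = {w. tiling_adj T v w} \<and> sorted_wrt (\<lambda>x y. Arg2pi (x - v) < Arg2pi (y - v)) ws"

definition monomeric_weights :: "complex set set \<Rightarrow> (complex \<Rightarrow> complex \<Rightarrow> real) \<Rightarrow> bool" where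
  "monomeric_weights T \<gamma> \<longleftrightarrow>
     (\<exists>L. \<forall>v\<in>tiling_vertices T. \<exists>ws k. ccw_neighbours T v ws \<and> map (\<gamma> v) ws = rotate k L)"


section \<open>Operators and flat bands\<close>

text \<open>Functions on the vertex set are represented by functions on the plane whose values off the
  vertex set are irrelevant.\<close>

definition weighted_adjacency ::
  "complex set set \<Rightarrow> (complex \<Rightarrow> complex \<Rightarrow> real) \<Rightarrow> complex \<Rightarrow> complex \<Rightarrow> real" where
  "weighted_adjacency T \<gamma> v w = (if tiling_adj T v w then \<gamma> v w else 0)"

text \<open>Action of a finite-range matrix: each row is supported on finitely many vertices.\<close>

definition matrix_op ::
  "complex set set \<Rightarrow> (complex \<Rightarrow> complex \<Rightarrow> real) \<Rightarrow> (complex \<Rightarrow> complex) \<Rightarrow> complex \<Rightarrow> complex" where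
  "matrix_op T A f v = (\<Sum>w | w \<in> tiling_vertices T \<and> A v w \<noteq> 0. of_real (A v w) * f w)"

definition vertex_weight :: "complex set set \<Rightarrow> (complex \<Rightarrow> complex \<Rightarrow> real) \<Rightarrow> complex \<Rightarrow> real" where
  "vertex_weight T \<gamma> v = (\<Sum>w | tiling_adj T v w. \<gamma> v w)"

text \<open>For constant or monomeric weights \<open>vertex_weight T \<gamma> v\<close> is the constant \<open>\<mu>\<close>.\<close>

definition laplacian ::
  "complex set set \<Rightarrow> (complex \<Rightarrow> complex \<Rightarrow> real) \<Rightarrow> (complex \<Rightarrow> complex) \<Rightarrow> complex \<Rightarrow> complex" where
  "laplacian T \<gamma> f v =
     f v - 1 / of_real (vertex_weight T \<gamma> v) * (\<Sum>w | tiling_adj T v w. of_real (\<gamma> v w) * f w)"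

definition bloch_space ::
  "complex set set \<Rightarrow> complex \<Rightarrow> complex \<Rightarrow> real \<times> real \<Rightarrow> (complex \<Rightarrow> complex) set" where
  "bloch_space T b1 b2 \<theta> =
     {f. \<forall>v\<in>tiling_vertices T. \<forall>\<beta>. f (lattice_shift b1 b2 \<beta> v) =
           cis (fst \<theta> * of_int (fst \<beta>) + snd \<theta> * of_int (snd \<beta>)) * f v}"

definition flat_band_at ::
  "complex set set \<Rightarrow> complex \<Rightarrow> complex \<Rightarrow> ((complex \<Rightarrow> complex) \<Rightarrow> complex \<Rightarrow> complex) \<Rightarrow> real \<Rightarrow> bool"
  where
  "flat_band_at T b1 b2 A E \<longleftrightarrow>
     (\<forall>\<theta>. \<exists>f\<in>bloch_space T b1 b2 \<theta>. (\<exists>v\<in>tiling_vertices T. f v \<noteq> 0) \<and>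
        (\<forall>v\<in>tiling_vertices T. A f v = of_real E * f v))"

definition has_flat_band ::
  "complex set set \<Rightarrow> complex \<Rightarrow> complex \<Rightarrow> ((complex \<Rightarrow> complex) \<Rightarrow> complex \<Rightarrow> complex) \<Rightarrow> bool" where
  "has_flat_band T b1 b2 A \<longleftrightarrow> (\<exists>E. flat_band_at T b1 b2 A E)"

end

theory Submission
  imports Defs
begin

text \<open>A flat band yields a nonzero eigenfunction of finite support. Such a function is excluded by peeling:
  if it vanishes at \<open>w\<close> and at all neighbours of \<open>w\<close> but \<open>x\<close>, then the eigenvalue equation at \<open>w\<close> and
  positivity of the weight of the edge from \<open>w\<close> to \<open>x\<close> give that it vanishes at \<open>x\<close>. Let \<open>v\<close> be the highest point of the
  support in a fixed generic direction. All vertices above \<open>v\<close> are zeros, and finitely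
  many peeling steps near \<open>v\<close> show that \<open>v\<close> is a zero too, a contradiction. The edges reached
  from a given vertex all have the same length, and their directions differ by 12th or 8th roots of unity.
  Hence only finitely many orientations of the vertex figure at \<open>v\<close> occur, positions near \<open>v\<close> have exact
  integer coordinates, and the peeling steps are verified by rewriting.\<close>

section \<open>Regular polygons\<close>

text \<open>The eigenvalue equation is used only at zeros of the function, so the energy drops out
  and one argument serves every energy. The main obstacle is that the tiling is given only through
  the numbers of sides around each vertex, up to rotation and reflection. No picture of the
  surroundings of the highest vertex is available in advance. They are explored edge by edge:
  crossing an edge carries over only its two adjacent tiles, every pattern compatible with those
  already found is followed, and the peeling must succeed for each. Global properties of the graph
  are avoided too: the highest vertex is sought among the vertices whose edge directions are
  compatible with one chosen edge \<open>e\<close>, a set closed under passing to neighbours.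
  Heights are taken after division by \<open>e\<close>, so the fixed direction is fixed relative to
  this edge. That direction is at 20 degrees because no multiple of 30 or 45 degrees is then
  perpendicular to it; every edge has a definite upper end, with a margin that absorbs the rounding
  of heights to integers.\<close>

text \<open>\<open>chord n k\<close> is the vector from the first to the \<open>k\<close>-th vertex of a regular \<open>n\<close>-gon whose first edge is 1;
  \<open>ngon n v d\<close> lies to the left of its edge from \<open>v\<close> to \<open>v + d\<close>.\<close>

definition chord :: "nat \<Rightarrow> nat \<Rightarrow> complex" where
  "chord n k = (cis (2 * pi * real k / real n) - 1) / (cis (2 * pi / real n) - 1)"

definition ngon :: "nat \<Rightarrow> complex \<Rightarrow> complex \<Rightarrow> complex set" where
  "ngon n v d = convex hull ((\<lambda>k. v + d * chord n k) ` {..<n})"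

definition interior_angle :: "nat \<Rightarrow> real" where
  "interior_angle n = pi - 2 * pi / real n"

text \<open>Half-angle form: it turns the question whether \<open>cis x\<close> equals 1 into the
  sign of a sine.\<close>

lemma cis_double_minus_one: "cis (2 * t) - 1 = 2 * \<i> * of_real (sin t) * cis t"
proof -
  have "cos (2 * t) - 1 = - 2 * sin t * sin t" 
    using cos_double_sin[of t] by (simp add: power2_eq_square)
  moreover have "sin (2 * t) = 2 * sin t * cos t" by (rule sin_double)
  ultimately show ?thesis by (auto simp: complex_eq_iff)
qed

lemma sin_pi_div_pos: "n \<ge> 2 \<Longrightarrow> 0 < k \<Longrightarrow> k < n \<Longrightarrow> 0 < sin (pi * real k / real n)"
  by (rule sin_gt_zero) (auto simp: field_simps)

lemma cis_step_neq_1: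
  assumes "n \<ge> 2" "0 < k" "k < n" shows "cis (2 * pi * real k / real n) \<noteq> 1"
proof -
  have "sin (pi * real k / real n) > 0" using assms by (intro sin_pi_div_pos) auto
  then have "cis (2 * (pi * real k / real n)) - 1 \<noteq> 0"
    by (subst cis_double_minus_one) simp
  then show ?thesis by (simp add: mult.assoc)
qed

lemma cis_root_neq_1: "n \<ge> 2 \<Longrightarrow> cis (2 * pi / real n) \<noteq> 1"
  using cis_step_neq_1[of n 1] by simp

text \<open>Inscribed angle theorem: seen from one vertex, consecutive vertices differ in direction
  by \<pi>/n, and their distances follow the sine rule.\<close>

lemma chord_polar:
  assumes "n \<ge> 2"
  shows "chord n k = of_real (sin (pi * real k / real n) / sin (pi / real n)) * cis (pi * (real k - 1) / real n)"
proof -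
  have s: "sin (pi / real n) > 0" using sin_pi_div_pos[of n 1] assms by simp
  have "cis (pi * (real k - 1) / real n) = cis (pi * real k / real n) / cis (pi / real n)"
    by (simp add: cis_divide diff_divide_distrib right_diff_distrib)
  moreover have "cis (2 * pi * real k / real n) - 1 = 2 * \<i> * of_real (sin (pi * real k / real n)) * cis (pi * real k / real n)"
    using cis_double_minus_one[of "pi * real k / real n"] by (simp add: mult.assoc)
  moreover have "cis (2 * pi / real n) - 1 = 2 * \<i> * of_real (sin (pi / real n)) * cis (pi / real n)"
    using cis_double_minus_one[of "pi / real n"] by simp
  ultimately show ?thesis using s by (simp add: chord_def field_simps)
qed

lemma chord_0 [simp]: "chord n 0 = 0"
  by (simp add: chord_def)

lemma chord_1 [simp]: "n \<ge> 2 \<Longrightarrow> chord n (Suc 0) = 1"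
  using cis_root_neq_1 by (simp add: chord_def)

lemma chord_full: "n \<ge> 2 \<Longrightarrow> chord n n = 0"
  by (simp add: chord_def)

text \<open>\<open>chord n k\<close> is a geometric sum of powers of the root of unity: a walk along
  \<open>k\<close> unit edges that turns by the exterior angle 2\<pi>/n after each.\<close>

lemma chord_Suc:
  assumes "n \<ge> 2" shows "chord n (Suc k) = 1 + cis (2 * pi / real n) * chord n k"
proof -
  have "cis (2 * pi * real (Suc k) / real n) = cis (2 * pi / real n) * cis (2 * pi * real k / real n)"
    by (simp add: cis_mult add_divide_distrib[symmetric] algebra_simps)
  then show ?thesis using cis_root_neq_1[OF assms]
    by (simp add: chord_def field_simps)
qed

lemma chord_last:
  assumes "n \<ge> 2" shows "chord n (n - 1) = cis (interior_angle n)"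
proof -
  have "sin (pi * real (n - 1) / real n) = sin (pi / real n)"
    using assms sin_pi_minus[of "pi / real n"] by (simp add: of_nat_diff field_simps)
  moreover have "pi * (real (n - 1) - 1) / real n = interior_angle n"
    using assms by (simp add: interior_angle_def of_nat_diff field_simps)
  moreover have "sin (pi / real n) > 0" using sin_pi_div_pos[of n 1] assms by simp
  ultimately show ?thesis using chord_polar[OF assms, of "n - 1"] by simp
qed

lemma chord_inj: 
  assumes "n \<ge> 2" shows "inj_on (chord n) {..<n}"
proof (rule linorder_inj_onI')
  fix i j assume ij: "i \<in> {..<n}" "j \<in> {..<n}" "i < j"
  have "cis (2 * pi * real (j - i) / real n) \<noteq> 1"
    using ij assms by (intro cis_step_neq_1) auto
  moreover have "cis (2 * pi * real j / real n) = cis (2 * pi * real i / real n) * cis (2 * pi * real (j - i) / real n)"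
    using ij by (simp add: cis_mult of_nat_diff field_simps)
  ultimately have "cis (2 * pi * real i / real n) \<noteq> cis (2 * pi * real j / real n)"
    by simp
  then show "chord n i \<noteq> chord n j" using cis_root_neq_1[OF assms]
    by (simp add: chord_def)
qed

lemma ngon_vertices_shift:
  assumes "n \<ge> 2"
  shows "(\<lambda>k. (v + d) + d * cis (2 * pi / real n) * chord n k) ` {..<n} = (\<lambda>k. v + d * chord n k) ` {..<n}"
proof -
  let ?F = "\<lambda>k. v + d * chord n k"
  have "(\<lambda>k. (v + d) + d * cis (2 * pi / real n) * chord n k) = (\<lambda>k. ?F (Suc k))"
    by (simp add: chord_Suc[OF assms] algebra_simps)
  moreover have "(\<lambda>k. ?F (Suc k)) ` {..<n} = ?F ` (Suc ` {..<n})" by (simp only: image_image)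
  moreover have "Suc ` {..<n} = insert n ({..<n} - {0})"
    using assms by (auto simp: image_Suc_lessThan)
  moreover have "?F n = ?F 0" by (simp add: chord_full[OF assms])
  ultimately show ?thesis using assms
    by (metis (no_types, lifting) image_insert insert_Diff lessThan_iff not_numeral_le_zero not_gr_zero)
qed

lemma ngon_shift: "n \<ge> 2 \<Longrightarrow> ngon n (v + d) (d * cis (2 * pi / real n)) = ngon n v d"
  unfolding ngon_def by (simp only: ngon_vertices_shift)

lemma ngon_shift_iter:
  assumes "n \<ge> 2"
  shows "ngon n (v + d * chord n k) (d * cis (2 * pi * real k / real n)) = ngon n v d"
proof (induction k)
  case (Suc k)
  let ?w = "cis (2 * pi / real n)"
  have e: "cis (2 * pi * real k / real n) = 1 + (?w - 1) * chord n k"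
    using cis_root_neq_1[OF assms] by (simp add: chord_def)
  have "v + d * chord n (Suc k) = (v + d * chord n k) + d * cis (2 * pi * real k / real n)"
    unfolding chord_Suc[OF assms] e by (simp add: algebra_simps)
  moreover have "d * cis (2 * pi * real (Suc k) / real n) = (d * cis (2 * pi * real k / real n)) * ?w"
    by (simp add: cis_mult mult.assoc add_divide_distrib[symmetric] algebra_simps)
  ultimately show ?case using Suc ngon_shift[OF assms] by metis
qed simp

text \<open>With the base point moved one vertex back, the last edge at \<open>v\<close> becomes the
  first edge of the same polygon; statements about last edges thus follow from those about first
  edges.\<close>

lemma ngon_shift_back:
  assumes "n \<ge> 2"
  shows "ngon n (v + d * cis (interior_angle n)) (- (d * cis (interior_angle n))) = ngon n v d"
proof -
  have "cis (interior_angle n) * cis (2 * pi / real n) = -1"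
    by (simp add: cis_mult interior_angle_def)
  then have "- (d * cis (interior_angle n)) * cis (2 * pi / real n) = d"
    by (simp add: mult.assoc)
  then show ?thesis
    using ngon_shift[OF assms, of "v + d * cis (interior_angle n)" "- (d * cis (interior_angle n))"] by simp
qed

section \<open>Vertices, edges and corners of a regular polygon\<close>

lemma vertices_on_circle:
  assumes "n \<ge> 2"
  shows "dist (v - d / (cis (2 * pi / real n) - 1)) (v + d * chord n k) = cmod (d / (cis (2 * pi / real n) - 1))"
proof -
  have "v - d / (cis (2 * pi / real n) - 1) - (v + d * chord n k)
     = - (d / (cis (2 * pi / real n) - 1)) * cis (2 * pi * real k / real n)"
    by (simp add: chord_def diff_divide_distrib right_diff_distrib)
  then show ?thesis by (simp only: dist_norm norm_mult norm_minus_cancel norm_cis mult_1_right)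
qed

text \<open>All vertices lie on the circumcircle. A point strictly inside a segment is closer to the
  centre than one of the endpoints, so a point at full radius is not inside a segment of the
  polygon.\<close>

lemma extreme_points_ngon:
  assumes "n \<ge> 2"
  shows "x extreme_point_of ngon n v d \<longleftrightarrow> x \<in> (\<lambda>k. v + d * chord n k) ` {..<n}"
proof
  show "x extreme_point_of ngon n v d \<Longrightarrow> x \<in> (\<lambda>k. v + d * chord n k) ` {..<n}"
    unfolding ngon_def by (rule extreme_point_of_convex_hull)
next
  assume x: "x \<in> (\<lambda>k. v + d * chord n k) ` {..<n}"
  define c where "c = v - d / (cis (2 * pi / real n) - 1)"
  define r where "r = cmod (d / (cis (2 * pi / real n) - 1))"
  have "ngon n v d \<subseteq> cball c r" unfolding ngon_def
    by (rule hull_minimal) (auto simp: c_def r_def vertices_on_circle[OF assms])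
  moreover have "dist c x = r" using x by (auto simp: c_def r_def vertices_on_circle[OF assms])
  moreover have "x \<in> ngon n v d" unfolding ngon_def using x by (rule hull_inc)
  ultimately show "x extreme_point_of ngon n v d"
    unfolding extreme_point_of_def using dist_decreases_open_segment[of x _ _ c]
    by (metis in_mono leD mem_cball)
qed

lemma card_extreme_points_ngon:
  assumes "n \<ge> 2" "d \<noteq> 0" shows "card {x. x extreme_point_of ngon n v d} = n"
proof -
  have "inj_on (\<lambda>k. v + d * chord n k) {..<n}"
    using chord_inj[OF assms(1)] assms(2) by (simp add: inj_on_def)
  then show ?thesis by (simp add: extreme_points_ngon[OF assms(1)] card_image)
qed

lemma ngon_sides_unique:
  "n \<ge> 2 \<Longrightarrow> m \<ge> 2 \<Longrightarrow> d \<noteq> 0 \<Longrightarrow> d' \<noteq> 0 \<Longrightarrow> ngon n v d = ngon m w d' \<Longrightarrow> n = m"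
  by (metis card_extreme_points_ngon)

lemma base_extreme_point_ngon: "n \<ge> 2 \<Longrightarrow> v extreme_point_of ngon n v d"
  unfolding extreme_points_ngon by (rule image_eqI[of _ _ 0]) auto

lemma regular_polygon_eq_ngon:
  assumes "regular_polygon n P" "v extreme_point_of P"
  obtains d where "d \<noteq> 0" "P = ngon n v d"
proof -
  from assms(1) obtain c r \<alpha> where n: "n \<ge> 3" and r: "r > 0"
    and P: "P = convex hull ((\<lambda>k. c + of_real r * cis (\<alpha> + 2 * pi * real k / real n)) ` {..<n})"
    unfolding regular_polygon_def by blast
  let ?w = "cis (2 * pi / real n) - 1"
  have w: "?w \<noteq> 0" using cis_root_neq_1[of n] n by simp
  define p where "p = c + of_real r * cis \<alpha>"
  define d where "d = of_real r * cis \<alpha> * ?w"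
  have d0: "d \<noteq> 0" using r w by (simp add: d_def)
  have "c + of_real r * cis (\<alpha> + 2 * pi * real k / real n) = p + d * chord n k" for k
  proof -
    have "d * chord n k = of_real r * cis \<alpha> * (cis (2 * pi * real k / real n) - 1)"
      using w by (simp add: d_def chord_def)
    then show ?thesis by (simp add: p_def cis_mult[symmetric] algebra_simps)
  qed
  then have P': "P = ngon n p d" by (simp add: P ngon_def)
  with assms(2) obtain k where "v = p + d * chord n k" using n by (auto simp: extreme_points_ngon)
  then have "P = ngon n v (d * cis (2 * pi * real k / real n))" using P' ngon_shift_iter[of n p d k] n by simp
  with d0 show thesis by (intro that[of "d * cis (2 * pi * real k / real n)"]) auto
qed

lemma first_edge_ngon:
  assumes n: "n \<ge> 3" and d: "d \<noteq> 0"
  shows "closed_segment v (v + d) edge_of ngon n v d"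
proof -
  let ?S = "(\<lambda>k. v + d * chord n k) ` {..<n}"
  \<comment> \<open>Signed distance to the line of the edge, in units of the length of
    \<open>d\<close>: zero on the edge, positive at all remaining vertices.\<close>
  let ?h = "\<lambda>z. Im ((z - v) / d)"
  have comb: "?h (a *\<^sub>R x + b *\<^sub>R y) = a * ?h x + b * ?h y" if "a + b = 1" for a b x y
  proof -
    have "v = a *\<^sub>R v + b *\<^sub>R v" using that by (metis scaleR_left_distrib scaleR_one)
    then have "(a *\<^sub>R x + b *\<^sub>R y - v) / d = (a *\<^sub>R (x - v) + b *\<^sub>R (y - v)) / d"
      by (simp add: algebra_simps)
    also have "\<dots> = a *\<^sub>R ((x - v) / d) + b *\<^sub>R ((y - v) / d)"
      by (simp add: add_divide_distrib scaleR_conv_of_real)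
    finally show ?thesis by simp
  qed
  have T: "{v, v + d} \<subseteq> ?S"
  proof -
    have "v = v + d * chord n 0" "v + d = v + d * chord n (Suc 0)" "0 < n" "Suc 0 < n" using n by auto
    then show ?thesis by blast
  qed
  have "affine {z. ?h z = 0}" unfolding affine_def using comb by simp
  moreover have "{v, v + d} \<subseteq> {z. ?h z = 0}" using d by simp
  ultimately have 1: "affine hull {v, v + d} \<subseteq> {z. ?h z = 0}"
    by (intro hull_minimal) auto
  have conv: "convex {z. ?h z > 0}" unfolding convex_def
  proof (intro ballI allI impI)
    fix x y and a b :: real assume *: "x \<in> {z. ?h z > 0}" "y \<in> {z. ?h z > 0}" "0 \<le> a" "0 \<le> b" "a + b = 1"
    then have "a * ?h x + b * ?h y > 0" 
      by (cases "a = 0") (auto intro!: add_pos_nonneg)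
    then show "a *\<^sub>R x + b *\<^sub>R y \<in> {z. ?h z > 0}" using comb * by simp
  qed
  have "?S - {v, v + d} \<subseteq> {z. ?h z > 0}"
  proof
    fix z assume z: "z \<in> ?S - {v, v + d}"
    then obtain k where k: "k < n" "z = v + d * chord n k" by auto
    have "z \<noteq> v" "z \<noteq> v + d" using z by auto
    then have "k \<noteq> 0" "k \<noteq> Suc 0" using k(2) n by (metis add.right_neutral chord_0 mult_zero_right)
        (metis chord_1 k(2) n mult.right_neutral \<open>z \<noteq> v + d\<close> Suc_leD numeral_3_eq_3 numeral_2_eq_2)
    then have k2: "k \<ge> 2" by simp
    have "?h z = Im (chord n k)" using k d by simp
    also have "\<dots> = sin (pi * real k / real n) / sin (pi / real n) * sin (pi * real (k - 1) / real n)"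
      using chord_polar[of n k] n k2 by (simp add: of_nat_diff)
    also have "\<dots> > 0"
      using sin_pi_div_pos[of n k] sin_pi_div_pos[of n 1] sin_pi_div_pos[of n "k - 1"] n k2 k(1)
      by simp
    finally show "z \<in> {z. ?h z > 0}" by simp
  qed
  with conv have 2: "convex hull (?S - {v, v + d}) \<subseteq> {z. ?h z > 0}" by (intro hull_minimal)
  have "convex hull {v, v + d} face_of ngon n v d"
    unfolding ngon_def
  proof (rule face_of_convex_hulls[OF _ T])
    show "affine hull {v, v + d} \<inter> convex hull (?S - {v, v + d}) = {}"
    proof (rule equals0I)
      fix x assume "x \<in> affine hull {v, v + d} \<inter> convex hull (?S - {v, v + d})"
      then have "x \<in> {z. ?h z = 0}" "x \<in> {z. ?h z > 0}" using 1 2 by blast+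
      then show False by simp
    qed
  qed simp
  then show ?thesis using d
    by (simp add: edge_of_def segment_convex_hull aff_dim_convex_hull)
qed

lemma last_edge_ngon:
  assumes n: "n \<ge> 3" and d: "d \<noteq> 0"
  shows "closed_segment v (v + d * cis (interior_angle n)) edge_of ngon n v d"
  using first_edge_ngon[of n "- (d * cis (interior_angle n))" "v + d * cis (interior_angle n)"] n d
    ngon_shift_back[of n v d] by (simp add: closed_segment_commute)

lemma interior_angle_bounds: 
  assumes "n \<ge> 3" shows "interior_angle n \<ge> pi / 3" "interior_angle n < pi"
proof -
  have "2 * pi / real n \<le> 2 * pi / 3" using assms by (intro divide_left_mono) auto
  then show "interior_angle n \<ge> pi / 3" by (simp add: interior_angle_def)
  show "interior_angle n < pi" using assms by (simp add: interior_angle_def)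
qed

lemma sin_interior_angle_pos: "n \<ge> 3 \<Longrightarrow> sin (interior_angle n) > 0"
  using interior_angle_bounds[of n] by (intro sin_gt_zero) (auto intro: less_le_trans[of 0 "pi/3"])

text \<open>Sine rule: the components of a vector in direction \<open>p\<close> along the two sides
  of a sector of angle \<open>a\<close>.\<close>

lemma cis_sector: "of_real (sin a) * cis p = of_real (sin (a - p)) + of_real (sin p) * cis a"
  by (auto simp: complex_eq_iff sin_diff algebra_simps)

text \<open>An edge at \<open>v\<close> ends at another vertex \<open>b\<close>. A diagonal would
  meet the segment between the two neighbours of \<open>v\<close> in an inner point, and the face
  property would put the neighbour \<open>p1\<close> on it; but the only extreme points of the edge
  are \<open>v\<close> and \<open>b\<close>.\<close>

lemma edges_at_vertex_ngon:
  assumes n: "n \<ge> 3" and d: "d \<noteq> 0" and e: "e edge_of ngon n v d" and v: "v \<in> e"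
  shows "e = closed_segment v (v + d) \<or> e = closed_segment v (v + d * cis (interior_angle n))"
proof -
  have n2: "n \<ge> 2" using n by simp
  let ?P = "ngon n v d" and ?\<alpha> = "interior_angle n"
  have f: "e face_of ?P" and dim: "aff_dim e = 1" using e by (auto simp: edge_of_def)
  have "compact ?P" unfolding ngon_def by (intro finite_imp_compact_convex_hull) auto
  then have "compact e" using f face_of_imp_compact face_of_imp_convex
    by (metis ngon_def convex_convex_hull)
  then obtain a b where ab: "e = closed_segment a b"
    using compact_convex_collinear_segment[of e] v dim face_of_imp_convex[OF f]
    by (metis collinear_aff_dim empty_iff order_refl)
  have ext: "x extreme_point_of e \<longleftrightarrow> x extreme_point_of ?P \<and> x \<in> e" for x
    using extreme_point_of_face[OF f] .
  have "v extreme_point_of e" using ext v base_extreme_point_ngon[OF n2] by blast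
  then obtain b where b: "e = closed_segment v b"
    using ab by (metis extreme_point_of_segment closed_segment_commute)
  have bv: "b \<noteq> v" using dim b by auto
  have "b extreme_point_of ?P" using ext[of b] b by (simp add: extreme_point_of_segment)
  then obtain k where k: "k < n" "b = v + d * chord n k" by (auto simp: extreme_points_ngon[OF n2])
  have k0: "k \<noteq> 0" using bv k by (cases k) auto
  have vert: "v + d * chord n j extreme_point_of ?P" if "j < n" for j
    using that by (auto simp: extreme_points_ngon[OF n2])
  have "k = 1 \<or> k = n - 1"
  proof (rule ccontr)
    assume *: "\<not> (k = 1 \<or> k = n - 1)"
    then have k': "1 < k" "k < n - 1" using k0 k(1) by auto
    define \<phi> where "\<phi> = pi * real (k - 1) / real n"
    define \<rho> where "\<rho> = sin (pi * real k / real n) / sin (pi / real n)"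
    have ck: "chord n k = of_real \<rho> * cis \<phi>" using chord_polar[OF n2, of k] k' by (simp add: \<rho>_def \<phi>_def of_nat_diff)
    have \<rho>: "\<rho> > 0" using sin_pi_div_pos[of n k] sin_pi_div_pos[of n 1] k' n unfolding \<rho>_def by simp
    have \<phi>: "0 < sin \<phi>" using sin_pi_div_pos[of n "k-1"] k' n2 unfolding \<phi>_def by simp
    have \<phi>2: "0 < sin (?\<alpha> - \<phi>)"
    proof -
      have "?\<alpha> - \<phi> = pi * real (n - 1 - k) / real n" using k' n
        by (simp add: interior_angle_def \<phi>_def of_nat_diff field_simps)
      then show ?thesis using sin_pi_div_pos[of n "n - 1 - k"] k' n2 by simp
    qed
    define q where "q = sin (?\<alpha> - \<phi>) + sin \<phi>"
    have q: "q > 0" using \<phi> \<phi>2 by (simp add: q_def)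
    \<comment> \<open>\<open>t\<close> is chosen so that the point \<open>x\<close> of the segment
      from \<open>p1\<close> to \<open>p2\<close> lies on the ray from \<open>v\<close> to
      \<open>b\<close>; \<open>\<tau>\<close> is its position on this ray.\<close>
    define t where "t = sin \<phi> / q"
    have t: "0 < t" "t < 1" using \<phi> \<phi>2 q by (auto simp: t_def q_def)
    define p1 p2 where "p1 = v + d" and "p2 = v + d * cis ?\<alpha>"
    have p1: "p1 extreme_point_of ?P" using vert[of "Suc 0"] n by (simp add: p1_def)
    have p2: "p2 extreme_point_of ?P" using vert[of "n - 1"] n chord_last[OF n2] by (simp add: p2_def)
    define x where "x = (1 - t) *\<^sub>R p1 + t *\<^sub>R p2"
    define \<tau> where "\<tau> = sin ?\<alpha> / (q * \<rho>)"
    have \<tau>: "\<tau> > 0" using sin_interior_angle_pos[OF n] q \<rho> by (simp add: \<tau>_def)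
    have x1: "x = v + d * (of_real (1 - t) + of_real t * cis ?\<alpha>)"
      by (simp add: x_def p1_def p2_def scaleR_conv_of_real algebra_simps)
    have "of_real (1 - t) + of_real t * cis ?\<alpha> = (of_real (sin (?\<alpha> - \<phi>)) + of_real (sin \<phi>) * cis ?\<alpha>) / of_real q"
    proof -
      have "1 - t = sin (?\<alpha> - \<phi>) / q" using q by (simp add: t_def q_def field_simps)
      then show ?thesis by (simp add: t_def add_divide_distrib)
    qed
    also have "\<dots> = of_real (sin ?\<alpha> / q) * cis \<phi>" by (simp add: cis_sector[symmetric])
    also have "\<dots> = of_real \<tau> * chord n k" using \<rho> by (simp add: ck \<tau>_def)
    finally have x2: "x = v + \<tau> *\<^sub>R (b - v)" using x1 k by (simp add: scaleR_conv_of_real)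
    have p12: "p1 \<noteq> p2"
    proof
      assume "p1 = p2"
      then have "cis ?\<alpha> = 1" using d by (simp add: p1_def p2_def)
      then have "sin ?\<alpha> = 0" by (metis cis.sel(2) one_complex.sel(2))
      then show False using sin_interior_angle_pos[OF n] by simp
    qed
    have xo: "x \<in> open_segment p1 p2" using t p12 by (auto simp: in_segment x_def)
    have pP: "p1 \<in> ?P" "p2 \<in> ?P" using p1 p2 by (auto simp: extreme_point_of_def)
    have xP: "x \<in> ?P" using xo pP
      by (metis convex_contains_open_segment convex_convex_hull in_mono ngon_def)
    \<comment> \<open>Otherwise \<open>b\<close> would lie strictly between \<open>v\<close> and
      \<open>x\<close> and could not be extreme.\<close>
    have "\<tau> \<le> 1"
    proof (rule ccontr)
      assume "\<not> \<tau> \<le> 1"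
      then have t1: "1 / \<tau> < 1" "0 < 1 / \<tau>" by auto
      have "b = (1 - 1 / \<tau>) *\<^sub>R v + (1 / \<tau>) *\<^sub>R x" using \<tau> by (simp add: x2 algebra_simps)
      moreover have "v \<noteq> x" using \<tau> bv by (simp add: x2)
      ultimately have "b \<in> open_segment v x" using t1 unfolding in_segment by blast
      moreover have "v \<in> ?P" using base_extreme_point_ngon[OF n2] by (auto simp: extreme_point_of_def)
      ultimately show False using \<open>b extreme_point_of ?P\<close> xP by (auto simp: extreme_point_of_def)
    qed
    then have "x \<in> e" unfolding b in_segment using \<tau>
      by (intro exI[of _ \<tau>]) (simp add: x2 algebra_simps)
    then have "p1 \<in> e" using f xo pP unfolding face_of_def by blast
    then have "p1 extreme_point_of e" using ext p1 by blast
    then have "p1 = v \<or> p1 = b" by (simp add: b extreme_point_of_segment)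
    then have "d * chord n 1 = d * chord n k" using d n k by (auto simp: p1_def)
    then have "chord n 1 = chord n k" using d by simp
    then have "k = 1" using chord_inj[OF n2] k n2 by (auto simp: inj_on_def)
    then show False using k' by simp
  qed
  then show ?thesis using b k n2 chord_last[OF n2] by auto
qed

text \<open>A small circular sector at the corner lies in the triangle of \<open>v\<close> and its
  two neighbours: by the bound on \<open>s\<close>, the barycentric weights \<open>A\<close> and
  \<open>B\<close> are at most 1/2 each.\<close>

lemma ngon_sector_point:
  assumes n: "n \<ge> 3" and p: "0 \<le> p" "p \<le> interior_angle n" and s: "0 \<le> s" "s \<le> sin (interior_angle n) / 2"
  shows "v + of_real s * d * cis p \<in> ngon n v d"
proof -
  let ?a = "interior_angle n"
  have n2: "n \<ge> 2" using n by simp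
  have sa: "sin ?a > 0" using sin_interior_angle_pos[OF n] .
  define A where "A = s * sin (?a - p) / sin ?a"
  define B where "B = s * sin p / sin ?a"
  have "sin (?a - p) \<ge> 0" "sin p \<ge> 0" using p interior_angle_bounds[OF n] by (auto intro!: sin_ge_zero)
  then have AB: "A \<ge> 0" "B \<ge> 0" using s sa by (auto simp: A_def B_def)
  have "s / sin ?a \<le> 1/2" "s / sin ?a \<ge> 0" using s sa by (auto simp: field_simps)
  then have "A \<le> 1/2 * 1" "B \<le> 1/2 * 1" 
    unfolding A_def B_def using \<open>sin (?a - p) \<ge> 0\<close> \<open>sin p \<ge> 0\<close>
    by (metis mult_mono sin_le_one times_divide_eq_left zero_le_divide_1_iff zero_le_numeral)+
  then have AB1: "A + B \<le> 1" by simp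
  have v: "v \<in> ngon n v d" and v1: "v + d \<in> ngon n v d" and v2: "v + d * cis ?a \<in> ngon n v d"
  proof -
    have "v + d * chord n k \<in> ngon n v d" if "k < n" for k
      unfolding ngon_def using that by (intro hull_inc) auto
    from this[of 0] this[of "Suc 0"] this[of "n - 1"] show "v \<in> ngon n v d" "v + d \<in> ngon n v d" "v + d * cis ?a \<in> ngon n v d"
      using n chord_last[OF n2] by auto
  qed
  have "convex hull {v, v + d, v + d * cis ?a} \<subseteq> ngon n v d"
    using v v1 v2 by (intro hull_minimal) (auto simp: ngon_def)
  moreover have "(1 - A - B) *\<^sub>R v + A *\<^sub>R (v + d) + B *\<^sub>R (v + d * cis ?a) \<in> convex hull {v, v + d, v + d * cis ?a}"
    unfolding convex_hull_3 using AB AB1 by (intro CollectI exI[of _ "1 - A - B"] exI[of _ A] exI[of _ B]) auto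
  moreover have "(1 - A - B) *\<^sub>R v + A *\<^sub>R (v + d) + B *\<^sub>R (v + d * cis ?a) = v + of_real s * d * cis p"
  proof -
    have "of_real A + of_real B * cis ?a = of_real s / of_real (sin ?a) * (of_real (sin (?a - p)) + of_real (sin p) * cis ?a)"
      by (simp add: A_def B_def add_divide_distrib algebra_simps)
    also have "\<dots> = of_real s * cis p" using sa by (simp add: cis_sector[symmetric])
    finally have "d * (of_real A + of_real B * cis ?a) = d * (of_real s * cis p)" by simp
    then show ?thesis by (simp add: scaleR_conv_of_real algebra_simps)
  qed
  ultimately show ?thesis by auto
qed

lemma interior_small_triangle:
  assumes "d \<noteq> 0" shows "interior (convex hull {v, v + d, v + d * cis (pi / 3)}) \<noteq> {}"
proof -
  have "\<not> collinear {0, d, d * cis (pi / 3)}"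
  proof
    assume "collinear {0, d, d * cis (pi / 3)}"
    then obtain c where "d * cis (pi / 3) = c *\<^sub>R d"
      using assms by (auto simp: collinear_lemma)
    then have "cis (pi / 3) = of_real c" using assms by (simp add: scaleR_conv_of_real mult.commute)
    then have "sin (pi / 3) = 0" by (metis Im_complex_of_real cis.sel(2))
    then show False by (simp add: sin_60)
  qed
  then have "\<not> affine_dependent {0, d, d * cis (pi / 3)}"
    using affine_dependent_imp_collinear_3 by blast
  then have "interior (convex hull {0, d, d * cis (pi / 3)}) \<noteq> {}"
  proof -
    have "card {0, d, d * cis (pi / 3)} = 3"
    proof -
      have "cis (pi / 3) \<noteq> 1" by (metis cis.sel(2) one_complex.sel(2) sin_60 divide_eq_0_iff real_sqrt_eq_0_iff zero_neq_numeral)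
      then show ?thesis using assms by (auto simp: card_insert_if)
    qed
    with \<open>\<not> affine_dependent _\<close> show ?thesis by (subst interior_convex_hull_eq_empty) auto
  qed
  moreover have "convex hull {v, v + d, v + d * cis (pi / 3)} = (+) v ` (convex hull {0, d, d * cis (pi / 3)})"
    using convex_hull_translation[of v "{0, d, d * cis (pi / 3)}"] by simp
  ultimately show ?thesis by (simp add: interior_translation)
qed

text \<open>Interior angles are at least 60 degrees, so both polygons contain the same small
  equilateral triangle along the common edge. In a tiling, a directed edge therefore has only one
  tile on its left.\<close>

lemma ngon_same_first_edge_overlap:
  assumes n: "n \<ge> 3" "m \<ge> 3" and d: "d \<noteq> 0"
  shows "interior (ngon n v d) \<inter> interior (ngon m v d) \<noteq> {}"
proof -
  define s where "s = min (sin (interior_angle n) / 2) (sin (interior_angle m) / 2)"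
  have s: "s > 0" using sin_interior_angle_pos n by (simp add: s_def)
  have "convex hull {v, v + of_real s * d, v + of_real s * d * cis (pi / 3)} \<subseteq> ngon k v d"
    if "k = n \<or> k = m" for k
  proof -
    have k: "k \<ge> 3" "s \<le> sin (interior_angle k) / 2" using that n by (auto simp: s_def)
    have a: "pi / 3 \<le> interior_angle k" "0 \<le> interior_angle k" using interior_angle_bounds(1)[OF k(1)] by (auto intro: order_trans[of 0 "pi/3"])
    have "v \<in> ngon k v d" "v + of_real s * d \<in> ngon k v d" "v + of_real s * d * cis (pi / 3) \<in> ngon k v d"
      using ngon_sector_point[OF k(1), of 0 0 v d] ngon_sector_point[OF k(1), of 0 s v d]
        ngon_sector_point[OF k(1), of "pi/3" s v d] a k s sin_interior_angle_pos[OF k(1)] by simp_all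
    then show ?thesis by (intro hull_minimal) (simp_all add: ngon_def)
  qed
  then have "interior (convex hull {v, v + of_real s * d, v + of_real s * d * cis (pi / 3)}) \<subseteq> interior (ngon n v d) \<inter> interior (ngon m v d)"
    using interior_mono by (metis le_inf_iff)
  then show ?thesis using interior_small_triangle[of "of_real s * d" v] s d by auto
qed

lemma ngon_same_last_edge_overlap:
  assumes n: "n \<ge> 3" "m \<ge> 3" and d: "d \<noteq> 0" and e: "d * cis (interior_angle n) = d' * cis (interior_angle m)"
  shows "interior (ngon n v d) \<inter> interior (ngon m v d') \<noteq> {}"
proof -
  have "ngon n v d = ngon n (v + d * cis (interior_angle n)) (- (d * cis (interior_angle n)))"
    "ngon m v d' = ngon m (v + d * cis (interior_angle n)) (- (d * cis (interior_angle n)))"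
    using ngon_shift_back[of n v d] ngon_shift_back[of m v d'] n e by auto
  then show ?thesis using ngon_same_first_edge_overlap[OF n, of "- (d * cis (interior_angle n))"] d by auto
qed

section \<open>Vertex figures\<close>

fun tiles_around :: "complex \<Rightarrow> complex \<Rightarrow> nat list \<Rightarrow> complex set list" where
  "tiles_around v d [] = []"
| "tiles_around v d (n # L) = ngon n v d # tiles_around v (d * cis (interior_angle n)) L"

fun edge_vectors :: "complex \<Rightarrow> nat list \<Rightarrow> complex list" where
  "edge_vectors d [] = []"
| "edge_vectors d (n # L) = d # edge_vectors (d * cis (interior_angle n)) L"

definition total_angle :: "nat list \<Rightarrow> real" where
  "total_angle L = sum_list (map interior_angle L)"

text \<open>Reversals are included because \<open>vertex_pattern\<close> leaves the sense of
  rotation open, whereas all lists below run counterclockwise.\<close>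

definition config_class :: "nat list \<Rightarrow> nat list set" where
  "config_class cfg = {L. \<exists>k. L = rotate k cfg \<or> L = rotate k (rev cfg)}"

lemma total_angle_simps [simp]:
  "total_angle [] = 0" "total_angle (n # L) = interior_angle n + total_angle L"
  "total_angle (L @ M) = total_angle L + total_angle M" "total_angle (rev L) = total_angle L"
  by (simp_all add: total_angle_def rev_map[symmetric])

lemma total_angle_rotate1 [simp]: "total_angle (rotate1 L) = total_angle L"
  by (cases L) auto

lemma total_angle_rotate [simp]: "total_angle (rotate k L) = total_angle L"
  by (induction k) auto

lemma length_tiles_around [simp]: "length (tiles_around v d L) = length L"
  by (induction L arbitrary: d) auto

lemma tiles_around_append:
  "tiles_around v d (L @ M) = tiles_around v d L @ tiles_around v (d * cis (total_angle L)) M"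
  by (induction L arbitrary: d) (auto simp: cis_mult mult.assoc)

lemma edge_vectors_append:
  "edge_vectors d (L @ M) = edge_vectors d L @ edge_vectors (d * cis (total_angle L)) M"
  by (induction L arbitrary: d) (auto simp: cis_mult mult.assoc)

lemma tiles_around_rotate1:
  assumes "cis (total_angle L) = 1"
  shows "tiles_around v (d * cis (interior_angle (hd L))) (rotate1 L) = rotate1 (tiles_around v d L)"
proof (cases L)
  case (Cons n M)
  have "cis (interior_angle n) * cis (total_angle M) = 1" using assms Cons by (simp add: cis_mult)
  then show ?thesis by (simp add: Cons tiles_around_append mult.assoc)
qed simp

lemma tiles_around_eqI:
  assumes "length Ps = length L" "\<And>i. i < length L \<Longrightarrow> Ps ! i = ngon (L ! i) v (x i)"
    and "\<And>i. Suc i < length L \<Longrightarrow> x (Suc i) = x i * cis (interior_angle (L ! i))"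
  shows "tiles_around v (x 0) L = Ps"
  using assms
proof (induction L arbitrary: Ps x)
  case (Cons n L)
  from Cons.prems(1) obtain P Ps' where Ps: "Ps = P # Ps'" "length Ps' = length L" by (cases Ps) auto
  have "tiles_around v (x (Suc 0)) L = Ps'"
  proof (rule Cons.IH[of Ps' "\<lambda>i. x (Suc i)"])
    fix i assume "i < length L"
    then show "Ps' ! i = ngon (L ! i) v (x (Suc i))" using Cons.prems(2)[of "Suc i"] Ps by simp
  next
    fix i assume "Suc i < length L"
    then show "x (Suc (Suc i)) = x (Suc i) * cis (interior_angle (L ! i))" using Cons.prems(3)[of "Suc i"] by simp
  qed (rule Ps)
  then have "tiles_around v (x 0 * cis (interior_angle n)) L = Ps'"
    using Cons.prems(3)[of 0] Ps(2) by (cases "L = []") simp_all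
  moreover have "P = ngon n v (x 0)" using Cons.prems(2)[of 0] Ps(1) by simp
  ultimately show ?case by (simp add: Ps(1))
qed simp

lemma edge_vectors_nth_Suc:
  assumes "Suc i < length L"
  shows "edge_vectors d L ! Suc i = edge_vectors d L ! i * cis (interior_angle (L ! i))"
  using assms
proof (induction L arbitrary: d i)
  case (Cons n L)
  then show ?case by (cases i; cases L) auto
qed simp

lemma tiles_around_nth_Suc:
  assumes "Suc i < length L"
  shows "tiles_around v d L ! Suc i = ngon (L ! Suc i) v (edge_vectors d L ! i * cis (interior_angle (L ! i)))"
  using assms
proof (induction L arbitrary: d i)
  case (Cons n L)
  then show ?case by (cases i; cases L) auto
qed simp

lemma config_class_rotate1: "L \<in> config_class cfg \<Longrightarrow> rotate1 L \<in> config_class cfg"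
  unfolding config_class_def by (blast intro: rotate_Suc[symmetric])

lemma config_class_length: "L \<in> config_class cfg \<Longrightarrow> length L = length cfg"
  by (auto simp: config_class_def)

lemma config_class_set: "L \<in> config_class cfg \<Longrightarrow> set L = set cfg"
  by (auto simp: config_class_def)

section \<open>Counterclockwise vertex figures in a tiling\<close>

locale archimedean =
  fixes T :: "complex set set" and cfg :: "nat list"
  assumes tiling: "archimedean_tiling cfg T"
    and length_cfg: "length cfg \<ge> 3"
    and sides: "\<And>n. n \<in> set cfg \<Longrightarrow> n \<ge> 3"
    and full_angle: "total_angle cfg = 2 * pi"
begin

text \<open>\<open>d\<close> is the edge from which the figure is read: the head of \<open>L\<close>
  belongs to the tile on its left, the last entry to the tile on its right.\<close>

definition star :: "complex \<Rightarrow> complex \<Rightarrow> nat list \<Rightarrow> bool" where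
  "star v d L \<longleftrightarrow> v \<in> tiling_vertices T \<and> d \<noteq> 0 \<and> L \<in> config_class cfg \<and>
     {P \<in> T. v \<in> P} = set (tiles_around v d L)"

lemma disjoint_interiors: "P \<in> T \<Longrightarrow> Q \<in> T \<Longrightarrow> interior P \<inter> interior Q \<noteq> {} \<Longrightarrow> P = Q"
  using tiling by (auto simp: archimedean_tiling_def tessellation_def)

text \<open>Edge-to-edge excludes vertices in the middle of a side: \<open>v\<close> is extreme in
  the common face of the two tiles, and extreme points of a face are extreme in the tile.\<close>

lemma vertex_extreme_point:
  assumes "v \<in> tiling_vertices T" "Q \<in> T" "v \<in> Q" shows "v extreme_point_of Q"
proof -
  from assms obtain P where P: "P \<in> T" "v extreme_point_of P" by (auto simp: tiling_vertices_def)
  show ?thesis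
  proof (cases "P = Q")
    case False
    then have f: "P \<inter> Q face_of P" "P \<inter> Q face_of Q"
      using tiling P(1) assms(2) by (auto simp: archimedean_tiling_def edge_to_edge_def)
    have "v \<in> P \<inter> Q" using P assms(3) by (auto simp: extreme_point_of_def)
    then show ?thesis using f P(2) extreme_point_of_face by blast
  qed (use P in auto)
qed

lemma tile_unique_first_edge:
  assumes "ngon n v d \<in> T" "ngon m v d \<in> T" "n \<ge> 3" "m \<ge> 3" "d \<noteq> 0" shows "n = m"
  using disjoint_interiors[OF assms(1,2)] ngon_same_first_edge_overlap[of n m d v] assms
    ngon_sides_unique[of n m d d v v] by auto

lemma class_sides: "L \<in> config_class cfg \<Longrightarrow> n \<in> set L \<Longrightarrow> n \<ge> 3"
  using sides config_class_set by blast

lemma class_total_angle: "L \<in> config_class cfg \<Longrightarrow> total_angle L = 2 * pi"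
  using full_angle by (auto simp: config_class_def)

lemma class_nonempty: "L \<in> config_class cfg \<Longrightarrow> L \<noteq> []"
  using config_class_length length_cfg by fastforce

lemma star_rotate1:
  assumes "star v d L" shows "star v (d * cis (interior_angle (hd L))) (rotate1 L)"
  using assms class_total_angle[of L] tiles_around_rotate1[of L v d] config_class_rotate1
  by (auto simp: star_def)

text \<open>Consecutive tiles of the vertex pattern share an edge at \<open>v\<close>. Disjointness of interiors forbids that
  this edge is the first (or the last) one of both tiles, and that the sense of rotation changes;
  so the tiles follow each other counterclockwise throughout or clockwise throughout.\<close>

lemma star_exists:
  assumes v: "v \<in> tiling_vertices T"
  obtains d L where "star v d L"
proof -
  have "vertex_pattern T cfg v" using tiling v by (auto simp: archimedean_tiling_def)
  then obtain Ps where dist: "distinct Ps" and Ps: "set Ps = {P\<in>T. v \<in> P}"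
    and reg: "list_all2 regular_polygon cfg Ps"
    and adj: "\<And>i. i<length Ps \<Longrightarrow> \<exists>e. v \<in> e \<and> e edge_of (Ps ! i) \<and> e edge_of (Ps ! (Suc i mod length Ps))"
    unfolding vertex_pattern_def by blast
  define N where "N = length cfg"
  have N: "length Ps = N" "N \<ge> 3" using reg length_cfg by (auto simp: N_def list_all2_lengthD)
  define a where "a i = interior_angle (cfg ! i)" for i
  have cfg3: "cfg ! i \<ge> 3" if "i < N" for i using sides that by (auto simp: N_def)
  have PT: "Ps ! i \<in> T" "v \<in> Ps ! i" if "i < N" for i using Ps N that nth_mem[of i Ps] by auto
  have "\<exists>d. d \<noteq> 0 \<and> Ps ! i = ngon (cfg ! i) v d" if "i < N" for i
  proof -
    have "regular_polygon (cfg ! i) (Ps ! i)" using reg that N by (auto simp: list_all2_conv_all_nth N_def)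
    then show ?thesis using regular_polygon_eq_ngon vertex_extreme_point[OF v PT[OF that]] by metis
  qed
  then obtain x where x: "\<And>i. i < N \<Longrightarrow> x i \<noteq> 0" "\<And>i. i < N \<Longrightarrow> Ps ! i = ngon (cfg ! i) v (x i)"
    by metis
  have same: "i = j" if "i < N" "j < N" "interior (Ps ! i) \<inter> interior (Ps ! j) \<noteq> {}" for i j
    using disjoint_interiors[OF PT(1)[OF that(1)] PT(1)[OF that(2)] that(3)] dist that N
    by (simp add: nth_eq_iff_index_eq)
  have first: "i = j" if "i < N" "j < N" "x i = x j" for i j
    using same[OF that(1,2)] ngon_same_first_edge_overlap[of "cfg ! i" "cfg ! j" "x i" v] x cfg3 that
    by auto
  have last: "i = j" if "i < N" "j < N" "x i * cis (a i) = x j * cis (a j)" for i j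
    using same[OF that(1,2)] ngon_same_last_edge_overlap[of "cfg ! i" "cfg ! j" "x i" "x j" v] x cfg3 that
    by (auto simp: a_def)
  let ?s = "\<lambda>i. Suc i mod N"
  have sN: "?s i < N" for i using N by simp
  have s1: "?s i \<noteq> i" if "i < N" for i
    using that N by (cases "Suc i = N") auto
  \<comment> \<open>This needs at least three tiles: the predecessor and the successor of a tile in
    the cycle are then different.\<close>
  have s2: "?s (?s i) \<noteq> i" if "i < N" for i
  proof -
    consider "Suc (Suc i) < N" | "Suc (Suc i) = N" | "Suc i = N" using \<open>i < N\<close> by linarith
    then show ?thesis using N by cases auto
  qed
  \<comment> \<open>The shared edge is the last one of one tile and the first one of the other; the
    disjuncts are counterclockwise and clockwise succession.\<close>
  have FB: "x (?s i) = x i * cis (a i) \<or> x i = x (?s i) * cis (a (?s i))" if i: "i < N" for i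
  proof -
    obtain e where e: "v \<in> e" "e edge_of (Ps ! i)" "e edge_of (Ps ! ?s i)" using adj i N by auto
    have eq: "\<exists>y. e = closed_segment v (v + y) \<and> (y = x j \<or> y = x j * cis (a j))" if "j < N" "e edge_of (Ps ! j)" for j
      using edges_at_vertex_ngon[of "cfg ! j" "x j" e v] cfg3 x that e(1) by (auto simp: a_def)
    obtain y where y: "e = closed_segment v (v + y)" "y = x i \<or> y = x i * cis (a i)" using eq i e(2) by blast
    obtain z where z: "e = closed_segment v (v + z)" "z = x (?s i) \<or> z = x (?s i) * cis (a (?s i))" using eq sN e(3) by blast
    have "y = z" using y(1) z(1) by (metis closed_segment_eq add_left_cancel doubleton_eq_iff)
    then show ?thesis using y(2) z(2) first[OF i sN[of i]] last[OF i sN[of i]] s1[OF i] by auto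
  qed
  have star: "star v d L" if "set (tiles_around v d L) = set Ps" "d \<noteq> 0" "L = cfg \<or> L = rev cfg" for d L
    using that v Ps by (auto simp: star_def config_class_def intro: exI[of _ 0])
  show thesis
  proof (cases "x (?s 0) = x 0 * cis (a 0)")
    case True
    have F: "x (?s i) = x i * cis (a i)" if "i < N" for i
      using that
    proof (induction i)
      case (Suc i)
      then have si: "?s i = Suc i" and i: "i < N" by auto
      have "\<not> x (Suc i) = x (?s (Suc i)) * cis (a (?s (Suc i)))"
      proof
        assume "x (Suc i) = x (?s (Suc i)) * cis (a (?s (Suc i)))"
        then have "x i * cis (a i) = x (?s (Suc i)) * cis (a (?s (Suc i)))" using Suc i si by simp
        then have "i = ?s (?s i)" using last[OF i sN] si by metis
        then show False using s2[OF i] by simp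
      qed
      then show ?case using FB[OF Suc.prems] by blast
    qed (use True in simp)
    have "tiles_around v (x 0) cfg = Ps"
    proof (rule tiles_around_eqI)
      fix i assume "Suc i < length cfg"
      then show "x (Suc i) = x i * cis (interior_angle (cfg ! i))" using F[of i] by (simp add: N_def a_def)
    qed (use N x in \<open>auto simp: N_def\<close>)
    then show thesis using star[of "x 0" cfg] x(1)[of 0] N that by auto
  next
    case False
    have B: "x i = x (?s i) * cis (a (?s i))" if "i < N" for i
      using that
    proof (induction i)
      case (Suc i)
      then have si: "?s i = Suc i" and i: "i < N" by auto
      have "\<not> x (?s (Suc i)) = x (Suc i) * cis (a (Suc i))"
      proof
        assume "x (?s (Suc i)) = x (Suc i) * cis (a (Suc i))"
        then have "x i = x (?s (Suc i))" using Suc i si by simp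
        then have "i = ?s (?s i)" using first[OF i sN] si by metis
        then show False using s2[OF i] by simp
      qed
      then show ?case using FB[OF Suc.prems] by blast
    qed (use False FB[of 0] N in auto)
    \<comment> \<open>In the clockwise case the reversed list runs counterclockwise, starting with
      the last tile.\<close>
    have "tiles_around v (x (N - 1 - 0)) (rev cfg) = rev Ps"
    proof (rule tiles_around_eqI[where x = "\<lambda>i. x (N - 1 - i)"])
      fix i assume "i < length (rev cfg)"
      then show "rev Ps ! i = ngon (rev cfg ! i) v (x (N - 1 - i))"
        using N x(2)[of "N - 1 - i"] by (simp add: rev_nth N_def)
    next
      fix i assume "Suc i < length (rev cfg)"
      then have i: "Suc i < N" by (simp add: N_def)
      then have "?s (N - 1 - Suc i) = N - 1 - i" by (simp add: Suc_diff_Suc)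
      then show "x (N - 1 - Suc i) = x (N - 1 - i) * cis (interior_angle (rev cfg ! i))"
        using B[of "N - 1 - Suc i"] i by (simp add: a_def rev_nth N_def)
    qed (use N in \<open>simp add: N_def\<close>)
    then show thesis using star[of "x (N - 1)" "rev cfg"] x(1)[of "N - 1"] N that by auto
  qed
qed

lemma star_first_tile: "star v d L \<Longrightarrow> ngon (hd L) v d \<in> T"
  using class_nonempty[of L] unfolding star_def by (cases L) auto

text \<open>The angles add up to 2\<pi>, so the last tile ends at \<open>d\<close>: its first edge
  is \<open>d\<close> turned back by its own angle.\<close>

lemma star_last_tile:
  assumes "star v d L" shows "ngon (last L) v (d * cis (- interior_angle (last L))) \<in> T"
proof -
  have L: "L \<in> config_class cfg" using assms by (auto simp: star_def)
  then have bl: "L = butlast L @ [last L]" using class_nonempty by simp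
  have "total_angle (butlast L) + interior_angle (last L) = 2 * pi"
    using class_total_angle[OF L] by (subst (asm) bl) simp
  then have "total_angle (butlast L) = 2 * pi + - interior_angle (last L)" by simp
  then have "cis (total_angle (butlast L)) = cis (- interior_angle (last L))"
    by (simp add: complex_eq_iff cos_diff sin_diff)
  moreover have "ngon (last L) v (d * cis (total_angle (butlast L))) \<in> set (tiles_around v d L)"
    by (subst bl, subst tiles_around_append) simp
  ultimately show ?thesis using assms by (auto simp: star_def)
qed

text \<open>Each edge direction determines the tile on its left, and this tile determines the next
  direction.\<close>

lemma star_unique:
  assumes "star v d L" "star v d M" shows "L = M"
proof -
  have "L = M" if "set (tiles_around v d L) \<subseteq> T" "set (tiles_around v d M) \<subseteq> T" "length L = length M" "d \<noteq> 0"
    "\<forall>n\<in>set L. n \<ge> 3" "\<forall>n\<in>set M. n \<ge> 3"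
    using that
  proof (induction L arbitrary: M d)
    case (Cons n L)
    then obtain m M' where M: "M = m # M'" by (cases M) auto
    have "n = m" using Cons.prems M tile_unique_first_edge[of n v d m] by auto
    then show ?case using Cons.IH[of "d * cis (interior_angle n)" M'] Cons.prems M by auto
  qed simp
  moreover have "set (tiles_around v d L) \<subseteq> T" "set (tiles_around v d M) \<subseteq> T"
    using assms by (auto simp: star_def)
  moreover have "length L = length M" "d \<noteq> 0" "\<forall>n\<in>set L. n \<ge> 3" "\<forall>n\<in>set M. n \<ge> 3"
    using assms config_class_length class_sides by (auto simp: star_def)
  ultimately show ?thesis by blast
qed

lemma star_rotate_nth:
  assumes "star v d L" "j < length L"
  shows "\<exists>y. tiles_around v d L ! j = ngon (L ! j) v y \<and> y \<noteq> 0 \<and> star v y (rotate j L)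
     \<and> edge_vectors d L ! j = y"
  using assms(2)
proof (induction j)
  case 0
  then show ?case using assms by (cases L) (auto simp: star_def)
next
  case (Suc j)
  then obtain y where y: "tiles_around v d L ! j = ngon (L ! j) v y" "y \<noteq> 0" "star v y (rotate j L)" "edge_vectors d L ! j = y" by auto
  have hd: "hd (rotate j L) = L ! j" using Suc.prems by (subst hd_rotate_conv_nth) auto
  show ?case using tiles_around_nth_Suc[OF Suc.prems, of v d] edge_vectors_nth_Suc[OF Suc.prems, of d]
      star_rotate1[OF y(3)] y Suc.prems hd by simp
qed

lemma length_edge_vectors [simp]: "length (edge_vectors d L) = length L"
  by (induction L arbitrary: d) auto

text \<open>If \<open>x\<close> and \<open>y\<close> were the two different edges at
  \<open>v\<close>, each would be the other one turned by the interior angle, and twice this angle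
  would be a full turn.\<close>

lemma edge_direction_unique:
  assumes "n \<ge> 3" "x \<noteq> 0" "ngon n v x = ngon n v y" "y \<noteq> 0" shows "x = y"
proof -
  let ?c = "cis (interior_angle n)"
  have seg: "p = q" if "closed_segment v (v + p) = closed_segment v (v + q)" for p q
    using that by (metis closed_segment_eq doubleton_eq_iff add_left_cancel)
  have "x = y \<or> x = y * ?c" 
    using edges_at_vertex_ngon[OF assms(1,4), of "closed_segment v (v + x)" v] first_edge_ngon[OF assms(1,2), of v] assms(3) seg
      ends_in_segment(1) by metis
  moreover have "x * ?c = y \<or> x * ?c = y * ?c" 
    using edges_at_vertex_ngon[OF assms(1,4), of "closed_segment v (v + x * ?c)" v] last_edge_ngon[OF assms(1,2), of v] assms(3) seg
      ends_in_segment(1) by metis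
  moreover have "\<not> (x = y * ?c \<and> x * ?c = y)"
  proof
    assume "x = y * ?c \<and> x * ?c = y"
    then have "?c * ?c = 1" using assms(2) by (metis mult.assoc mult_cancel_left mult.right_neutral)
    then have "cis (2 * interior_angle n) = 1" by (simp add: cis_mult)
    then have "2 * \<i> * of_real (sin (interior_angle n)) * ?c = 0" using cis_double_minus_one[of "interior_angle n"] by simp
    then show False using sin_interior_angle_pos[OF assms(1)] by simp
  qed
  ultimately show ?thesis by auto
qed

text \<open>Reversing an edge exchanges its sides. Only the two tiles at the edge are carried over
  to the far end, which is why exploration may branch.\<close>

lemma star_cross:
  assumes s: "star v d L"
  shows "\<exists>M. star (v + d) (- d) M \<and> hd M = last L \<and> last M = hd L"
proof -
  let ?w = "v + d"
  have L: "L \<in> config_class cfg" and d: "d \<noteq> 0" using s by (auto simp: star_def)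
  then have ne: "L \<noteq> []" using class_nonempty by blast
  define h where "h = hd L"
  define l where "l = last L"
  have h: "h \<ge> 3" and l: "l \<ge> 3" using class_sides[OF L] ne by (auto simp: h_def l_def)
  have Q: "ngon h v d \<in> T" using star_first_tile[OF s] by (simp add: h_def)
  have Q': "ngon h ?w (d * cis (2 * pi / real h)) = ngon h v d" using ngon_shift h by simp
  have wex: "?w extreme_point_of ngon h v d" using base_extreme_point_ngon[of h ?w "d * cis (2 * pi / real h)"] Q' h by simp
  then have wV: "?w \<in> tiling_vertices T" using Q by (auto simp: tiling_vertices_def)
  then obtain y0 L0 where s0: "star ?w y0 L0" using star_exists by blast
  have L0: "L0 \<in> config_class cfg" using s0 by (auto simp: star_def)
  have "ngon h v d \<in> {P \<in> T. ?w \<in> P}" using Q wex by (auto simp: extreme_point_of_def)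
  then have "ngon h v d \<in> set (tiles_around ?w y0 L0)" using s0 by (auto simp only: star_def)
  then obtain i where i: "i < length L0" "tiles_around ?w y0 L0 ! i = ngon h v d"
    by (auto simp: in_set_conv_nth)
  obtain y where y: "ngon h v d = ngon (L0 ! i) ?w y" "y \<noteq> 0" "star ?w y (rotate i L0)"
    using star_rotate_nth[OF s0 i(1)] i(2) by auto
  have "L0 ! i \<ge> 3" using class_sides[OF L0] i by simp
  then have hi: "L0 ! i = h" using ngon_sides_unique[of h "L0 ! i" d y v ?w] h d y by auto
  \<comment> \<open>Seen from the far end, the tile starts one exterior angle past \<open>d\<close>,
    so its second edge there is \<open>- d\<close>; one further rotation makes it the last
    tile.\<close>
  have yd: "y = d * cis (2 * pi / real h)" 
    using edge_direction_unique[of h y ?w "d * cis (2 * pi / real h)"] Q' y hi h d by auto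
  have "cis (2 * pi / real h) * cis (interior_angle h) = - 1" by (simp add: cis_mult interior_angle_def)
  then have yc: "y * cis (interior_angle h) = - d" by (simp add: yd mult.assoc)
  have hd: "hd (rotate i L0) = h" using i hi by (subst hd_rotate_conv_nth) auto
  define M where "M = rotate1 (rotate i L0)"
  have sM: "star ?w (- d) M" using star_rotate1[OF y(3)] hd yc by (simp add: M_def)
  have "rotate i L0 \<noteq> []" using i by auto
  then have lastM: "last M = h" using hd by (cases "rotate i L0") (auto simp: M_def)
  have M: "M \<in> config_class cfg" using sM by (auto simp: star_def)
  have "hd M \<ge> 3" using class_sides[OF M] class_nonempty[OF M] by simp
  moreover have "ngon (hd M) ?w (- d) \<in> T" using star_first_tile[OF sM] .
  moreover have "ngon l ?w (- d) \<in> T"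
  proof -
    have "- d * cis (2 * pi / real l) = d * cis (- interior_angle l)"
      by (simp add: complex_eq_iff interior_angle_def cos_diff sin_diff)
    then have "ngon l v (d * cis (- interior_angle l)) = ngon l ?w (- d)"
      using ngon_shift[of l ?w "- d"] l by simp
    then show ?thesis using star_last_tile[OF s] by (simp add: l_def)
  qed
  ultimately have "hd M = l" using tile_unique_first_edge[of "hd M" ?w "- d" l] l d by simp
  then show ?thesis using sM lastM by (auto simp: h_def l_def)
qed

lemma star_neighbours:
  assumes s: "star v d L"
  shows "{w. tiling_adj T v w} = (+) v ` set (edge_vectors d L)"
proof (intro equalityI subsetI)
  have L: "L \<in> config_class cfg" using s by (auto simp: star_def)
  fix w assume "w \<in> {w. tiling_adj T v w}"
  then obtain P where P: "P \<in> T" "closed_segment v w edge_of P" by (auto simp: tiling_adj_def)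
  have "v \<in> P" using P(2) edge_of_imp_subset by fastforce
  then have "P \<in> set (tiles_around v d L)" using s P(1) by (auto simp: star_def)
  then obtain i where i: "i < length L" "tiles_around v d L ! i = P"
    by (auto simp: in_set_conv_nth)
  obtain y where y: "P = ngon (L ! i) v y" "y \<noteq> 0" "star v y (rotate i L)" "edge_vectors d L ! i = y"
    using star_rotate_nth[OF s i(1)] i(2) by auto
  have n: "L ! i \<ge> 3" using class_sides[OF L] i by simp
  have seg: "w = v + q" if "closed_segment v w = closed_segment v (v + q)" for q
    using that by (metis closed_segment_eq doubleton_eq_iff)
  from edges_at_vertex_ngon[OF n y(2), of "closed_segment v w" v] P y(1) seg
  have "w = v + y \<or> w = v + y * cis (interior_angle (L ! i))" by (metis ends_in_segment(1))
  moreover have "v + y \<in> (+) v ` set (edge_vectors d L)" using y(4) i by (metis image_eqI length_edge_vectors nth_mem)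
  moreover have "y * cis (interior_angle (L ! i)) \<in> set (edge_vectors d L)"
  proof (cases "Suc i < length L")
    case True
    have "edge_vectors d L ! Suc i = edge_vectors d L ! i * cis (interior_angle (L ! i))" if "Suc i < length L" for L d i
      using that by (rule edge_vectors_nth_Suc)
    then have "edge_vectors d L ! Suc i = y * cis (interior_angle (L ! i))" using True y(4) by simp
    then show ?thesis using True by (metis length_edge_vectors nth_mem)
  next
    \<comment> \<open>After the last tile the full turn leads back to the first edge
      \<open>d\<close>.\<close>
    case False
    then have i': "i = length L - 1" using i by simp
    have "L \<noteq> []" using i by auto
    then have bl: "L = butlast L @ [L ! i]" using i' by (metis append_butlast_last_id last_conv_nth)
    have "edge_vectors d (butlast L @ [L ! i]) ! i = d * cis (total_angle (butlast L))"
      unfolding edge_vectors_append by (simp add: nth_append i')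
    then have "edge_vectors d L ! i = d * cis (total_angle (butlast L))"
      using bl by simp
    moreover have "cis (total_angle (butlast L)) * cis (interior_angle (L ! i)) = 1"
    proof -
      have "total_angle (butlast L) + interior_angle (L ! i) = 2 * pi"
        using class_total_angle[OF L] by (subst (asm) bl) simp
      then show ?thesis by (simp add: cis_mult)
    qed
    ultimately have "y * cis (interior_angle (L ! i)) = d" using y(4) by (simp add: mult.assoc)
    moreover have "d \<in> set (edge_vectors d L)" using i by (cases L) auto
    ultimately show ?thesis by simp
  qed
  ultimately show "w \<in> (+) v ` set (edge_vectors d L)" by auto
next
  have L: "L \<in> config_class cfg" using s by (auto simp: star_def)
  fix w assume "w \<in> (+) v ` set (edge_vectors d L)"
  then obtain i where i: "i < length L" "w = v + edge_vectors d L ! i" by (auto simp: in_set_conv_nth)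
  obtain y where y: "y \<noteq> 0" "star v y (rotate i L)" "edge_vectors d L ! i = y"
    using star_rotate_nth[OF s i(1)] by auto
  have "hd (rotate i L) \<ge> 3" using class_sides[OF L, of "L ! i"] i by (subst hd_rotate_conv_nth) auto
  then show "w \<in> {w. tiling_adj T v w}" 
    using first_edge_ngon[of "hd (rotate i L)" y v] y i star_first_tile[OF y(2)] by (auto simp: tiling_adj_def)
qed

text \<open>Between two edges lie some but not all of the tiles, so the enclosed angle is strictly
  between 0 and 2\<pi>. This gives the number of neighbours, hence the vertex weight for constant
  weights.\<close>

lemma edge_vectors_distinct:
  assumes "star v d L" shows "distinct (edge_vectors d L)"
proof -
  have L: "L \<in> config_class cfg" and d: "d \<noteq> 0" using assms by (auto simp: star_def)
  have nth: "edge_vectors d L ! i = d * cis (total_angle (take i L))" if "i < length L" for i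
    using that
  proof (induction i)
    case (Suc i)
    then show ?case using edge_vectors_nth_Suc[OF Suc.prems, of d]
      by (simp add: take_Suc_conv_app_nth cis_mult mult.assoc)
  qed (use class_nonempty[OF L] in \<open>cases L; simp\<close>)
  show ?thesis unfolding distinct_conv_nth
  proof (intro allI impI)
    fix i j assume "i < length (edge_vectors d L)" "j < length (edge_vectors d L)" "i \<noteq> j"
    then show "edge_vectors d L ! i \<noteq> edge_vectors d L ! j"
    proof (induction i j rule: linorder_wlog)
      case (le i j)
      then have ij: "i < j" "j < length L" by auto
      define M where "M = drop i (take j L)"
      have split: "take j L = take i L @ M" using ij by (simp add: M_def min_def flip: take_take[of i j L])
          (metis append_take_drop_id min.absorb1 less_imp_le take_take)
      have "M \<noteq> []" using ij by (simp add: M_def)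
      have pos: "total_angle K > 0" if "K \<noteq> []" "set K \<subseteq> set L" for K
        using that
      proof (induction K)
        case (Cons n K)
        then have "interior_angle n > 0"
          using class_sides[OF L, of n] interior_angle_bounds(1)[of n] pi_gt_zero by (smt (verit) list.set_intros(1) subset_iff divide_pos_pos)
        then show ?case using Cons by (cases "K = []") auto
      qed simp
      have "total_angle M > 0" using \<open>M \<noteq> []\<close>
        by (intro pos) (auto simp: M_def dest: in_set_dropD in_set_takeD)
      moreover have "total_angle M < 2 * pi"
      proof -
        have "L = take i L @ M @ drop j L" using split by (metis append.assoc append_take_drop_id)
        then have "total_angle (take i L) + total_angle M + total_angle (drop j L) = 2 * pi"
          using class_total_angle[OF L] by (metis add.assoc total_angle_simps(3))
        moreover have "total_angle (drop j L) > 0" using pos[of "drop j L"] ij by (simp add: set_drop_subset)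
        moreover have "total_angle (take i L) \<ge> 0"
          using pos[of "take i L"] by (cases "take i L = []") (auto simp: set_take_subset less_imp_le)
        ultimately show ?thesis by linarith
      qed
      ultimately have "sin (total_angle M / 2) > 0" by (intro sin_gt_zero) auto
      then have "cis (total_angle M) \<noteq> 1" using cis_double_minus_one[of "total_angle M / 2"] by auto
      then show ?case using nth ij d split by (simp flip: cis_mult)
    qed (use \<open>i \<noteq> j\<close> in auto)
  qed
qed

lemma vertex_weight_pos:
  assumes "edge_weights T \<gamma>" "v \<in> tiling_vertices T"
  shows "vertex_weight T \<gamma> v > 0"
proof -
  obtain d L where st: "star v d L" using star_exists[OF assms(2)] by blast
  have "L \<noteq> []" using class_nonempty st by (auto simp: star_def)
  then have "{w. tiling_adj T v w} \<noteq> {}" "finite {w. tiling_adj T v w}"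
    unfolding star_neighbours[OF st] by (cases L; simp)+
  moreover have "\<gamma> v w > 0" if "tiling_adj T v w" for w using assms(1) that by (simp add: edge_weights_def)
  ultimately show ?thesis unfolding vertex_weight_def by (intro sum_pos) auto
qed

end

section \<open>From flat bands to finitely supported eigenfunctions\<close>

text \<open>One elimination step per equation: the unknown with pivot index \<open>p\<close>, whose
  coefficient at \<open>x\<close> is nonzero, is expressed by the others, and \<open>G\<close> is
  the remaining system.\<close>

lemma underdetermined_system:
  fixes F :: "'i \<Rightarrow> 'x \<Rightarrow> complex"
  assumes "finite X" "finite I" "card X < card I"
  shows "\<exists>a. (\<exists>i\<in>I. a i \<noteq> 0) \<and> (\<forall>x\<in>X. (\<Sum>i\<in>I. a i * F i x) = 0)"
  using assms
proof (induction X arbitrary: I F rule: finite_induct)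
  case empty
  then obtain i where "i \<in> I" by fastforce
  then show ?case by (intro exI[of _ "\<lambda>_. 1"]) auto
next
  case (insert x X)
  show ?case
  proof (cases "\<forall>i\<in>I. F i x = 0")
    case True
    with insert.IH[of I F] insert.prems insert.hyps show ?thesis by auto
  next
    case False
    then obtain p where p: "p \<in> I" "F p x \<noteq> 0" by blast
    define G where "G i y = F i y - F i x / F p x * F p y" for i y
    have "card X < card (I - {p})" using insert.prems insert.hyps p(1) by simp
    then obtain a where a: "\<exists>i\<in>I - {p}. a i \<noteq> 0" "\<forall>y\<in>X. (\<Sum>i\<in>I - {p}. a i * G i y) = 0"
      using insert.IH[of "I - {p}" G] insert.prems by auto
    define b where "b = a(p := - (\<Sum>i\<in>I - {p}. a i * F i x / F p x))"
    have "(\<Sum>i\<in>I. b i * F i y) = (\<Sum>i\<in>I - {p}. a i * G i y)" for y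
    proof -
      have "(\<Sum>i\<in>I. b i * F i y) = b p * F p y + (\<Sum>i\<in>I - {p}. b i * F i y)"
        using insert.prems p(1) by (simp add: sum.remove)
      also have "(\<Sum>i\<in>I - {p}. b i * F i y) = (\<Sum>i\<in>I - {p}. a i * F i y)"
        by (intro sum.cong) (auto simp: b_def)
      also have "b p * F p y = - (\<Sum>i\<in>I - {p}. a i * (F i x / F p x * F p y))"
        by (simp add: b_def sum_distrib_right mult.assoc)
      finally show ?thesis by (simp add: G_def right_diff_distrib sum_subtractf)
    qed
    moreover have "(\<Sum>i\<in>I - {p}. a i * G i x) = 0" using p(2) by (simp add: G_def)
    moreover have "\<exists>i\<in>I. b i \<noteq> 0" using a(1) by (auto simp: b_def)
    ultimately show ?thesis using a(2) by (intro exI[of _ b]) auto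
  qed
qed

lemma character_orthogonality:
  assumes "N \<ge> 2" "p < N" "q < N"
  shows "(\<Sum>i<N. cis (2 * pi * real p / real N * real i) * cis (- (2 * pi * real q / real N * real i)))
     = (if p = q then of_nat N else 0)"
proof (cases "p = q")
  case False
  define x where "x = cis (2 * pi * real p / real N) * cis (- (2 * pi * real q / real N))"
  have "x \<noteq> 1"
  proof
    assume "x = 1"
    then have "cis (2 * pi * real p / real N) = cis (2 * pi * real q / real N)"
      by (simp add: x_def cis_inverse[symmetric] divide_inverse[symmetric] del: cis_inverse)
    then have "chord N p = chord N q" by (simp add: chord_def)
    then show False using chord_inj[OF assms(1)] assms False by (auto simp: inj_on_def)
  qed
  moreover have "x ^ N = 1"
  proof -
    have "cis (2 * pi * real p / real N) ^ N = 1" "cis (- (2 * pi * real q / real N)) ^ N = 1"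
      using assms(1) cis_multiple_2pi[of "real p"] cis_multiple_2pi[of "- real q"]
      by (simp_all add: Complex.DeMoivre)
    then show ?thesis by (simp add: x_def power_mult_distrib)
  qed
  ultimately have "(\<Sum>i<N. x ^ i) = 0" by (simp add: geometric_sum)
  moreover have "cis (2 * pi * real p / real N * real i) * cis (- (2 * pi * real q / real N * real i)) = x ^ i" for i
    by (simp add: x_def power_mult_distrib Complex.DeMoivre mult_ac)
  ultimately show ?thesis using False by simp
qed (simp add: cis_mult)

text \<open>Common form to which flat bands of both operators are reduced; for the Laplacian the
  energy changes on the way.\<close>

definition flat_eigenvalue ::
  "complex set set \<Rightarrow> complex \<Rightarrow> complex \<Rightarrow> (complex \<Rightarrow> complex \<Rightarrow> real) \<Rightarrow> complex \<Rightarrow> bool" where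
  "flat_eigenvalue T b1 b2 \<gamma> E \<longleftrightarrow>
     (\<forall>\<theta>. \<exists>f\<in>bloch_space T b1 b2 \<theta>. (\<exists>v\<in>tiling_vertices T. f v \<noteq> 0) \<and>
        (\<forall>v\<in>tiling_vertices T. (\<Sum>w | tiling_adj T v w. of_real (\<gamma> v w) * f w) = E * f v))"

section \<open>Lattice coordinates and cells\<close>

locale lattice_tiling = archimedean +
  fixes b1 b2 :: complex
  assumes basis: "lattice_basis T b1 b2"
begin

abbreviation "lat \<equiv> lattice_vec b1 b2"

lemma lat_uminus: "lat (- i, - j) = - lat (i, j)"
  by (simp add: lattice_vec_def)

lemma lat_translation: "lat \<beta> \<in> tiling_translations T"
  using basis by (auto simp: lattice_basis_def bij_betw_def)

lemma lat_inj: "lat \<beta> = lat \<beta>' \<Longrightarrow> \<beta> = \<beta>'"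
  using basis unfolding lattice_basis_def bij_betw_def by (blast dest: injD)

lemma tile_translate: "P \<in> T \<Longrightarrow> (+) (lat \<beta>) ` P \<in> T"
proof -
  assume P: "P \<in> T"
  have "(\<lambda>P. (\<lambda>x. x + lat \<beta>) ` P) ` T = T" using lat_translation by (simp add: tiling_translations_def)
  then have "(\<lambda>x. x + lat \<beta>) ` P \<in> T" using P by blast
  then show ?thesis by (simp add: add.commute)
qed

lemma vertex_translate: "v \<in> tiling_vertices T \<Longrightarrow> v + lat \<beta> \<in> tiling_vertices T"
proof -
  assume "v \<in> tiling_vertices T"
  then obtain P where P: "P \<in> T" "v extreme_point_of P" by (auto simp: tiling_vertices_def)
  then have "lat \<beta> + v extreme_point_of (+) (lat \<beta>) ` P" 
    by (simp add: extreme_point_of_translation_eq)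
  then show ?thesis using tile_translate[OF P(1)] unfolding tiling_vertices_def add.commute[of v] by blast
qed

lemma adj_translate: "tiling_adj T v w \<Longrightarrow> tiling_adj T (v + lat \<beta>) (w + lat \<beta>)"
proof -
  assume "tiling_adj T v w"
  then obtain P where P: "P \<in> T" "closed_segment v w edge_of P" by (auto simp: tiling_adj_def)
  then have "(+) (lat \<beta>) ` closed_segment v w edge_of (+) (lat \<beta>) ` P"
    by (simp add: edge_of_def aff_dim_translation_eq face_of_translation_eq)
  then have "closed_segment (v + lat \<beta>) (w + lat \<beta>) edge_of (+) (lat \<beta>) ` P"
    unfolding closed_segment_translation[symmetric] by (simp only: add.commute)
  then show ?thesis using tile_translate[OF P(1)] unfolding tiling_adj_def by blast
qed

lemma adjacent_is_vertex: "tiling_adj T v w \<Longrightarrow> w \<in> tiling_vertices T"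
proof -
  assume "tiling_adj T v w"
  then obtain P where P: "P \<in> T" "closed_segment v w face_of P" by (auto simp: tiling_adj_def edge_of_def)
  have "w extreme_point_of closed_segment v w" by (simp add: extreme_point_of_segment)
  then show ?thesis using extreme_point_of_face[OF P(2)] P(1) by (auto simp: tiling_vertices_def)
qed

lemma tile_hull:
  assumes "P \<in> T" obtains S where "finite S" "P = convex hull S"
proof -
  from assms obtain n where "regular_polygon n P" using tiling by (auto simp: archimedean_tiling_def)
  then obtain c r \<alpha> where "P = convex hull ((\<lambda>k. c + of_real r * cis (\<alpha> + 2 * pi * real k / real n)) ` {..<n})"
    unfolding regular_polygon_def by blast
  then show thesis by (intro that) auto
qed

lemma finite_extreme_points: "P \<in> T \<Longrightarrow> finite {x. x extreme_point_of P}"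
proof -
  assume "P \<in> T"
  then obtain S where "finite S" "P = convex hull S" using tile_hull by blast
  then show ?thesis using extreme_points_of_convex_hull finite_subset by metis
qed

lemma finite_vertices_bounded: "bounded K \<Longrightarrow> finite (tiling_vertices T \<inter> K)"
proof -
  assume "bounded K"
  then have "finite {P\<in>T. P \<inter> K \<noteq> {}}" using tiling by (auto simp: archimedean_tiling_def tessellation_def)
  then have "finite (\<Union>P\<in>{P\<in>T. P \<inter> K \<noteq> {}}. {x. x extreme_point_of P})"
    using finite_extreme_points by blast
  moreover have "tiling_vertices T \<inter> K \<subseteq> (\<Union>P\<in>{P\<in>T. P \<inter> K \<noteq> {}}. {x. x extreme_point_of P})"
    by (auto simp: tiling_vertices_def extreme_point_of_def)
  ultimately show ?thesis by (rule finite_subset[rotated])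
qed

lemma vertex_exists: "\<exists>v. v \<in> tiling_vertices T"
proof -
  have "0 \<in> \<Union>T" using tiling by (simp add: archimedean_tiling_def tessellation_def)
  then obtain P where P: "P \<in> T" "0 \<in> P" by blast
  then obtain S where "finite S" "P = convex hull S" using tile_hull by blast
  then have "compact P" "convex P" by (auto intro: finite_imp_compact_convex_hull)
  then obtain x where "x extreme_point_of P" using extreme_point_exists_convex[of P] P(2) by blast
  then show ?thesis using P(1) by (auto simp: tiling_vertices_def)
qed

text \<open>Local finiteness of the tiling makes the translation group discrete.\<close>

lemma finite_short_lattice_vectors: "finite {\<beta>. norm (lat \<beta>) \<le> r}"
proof -
  obtain v where v: "v \<in> tiling_vertices T" using vertex_exists by blast
  have "(\<lambda>\<beta>. v + lat \<beta>) ` {\<beta>. norm (lat \<beta>) \<le> r} \<subseteq> tiling_vertices T \<inter> cball v r"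
    using vertex_translate[OF v] by (auto simp: dist_norm)
  then have "finite ((\<lambda>\<beta>. v + lat \<beta>) ` {\<beta>. norm (lat \<beta>) \<le> r})"
    using finite_vertices_bounded[of "cball v r"] by (rule finite_subset) simp
  moreover have "inj_on (\<lambda>\<beta>. v + lat \<beta>) A" for A by (auto intro!: inj_onI lat_inj)
  ultimately show ?thesis by (rule finite_imageD)
qed

definition lattice_det where "lattice_det = Im (b1 * cnj b2)"

text \<open>If the basis vectors were parallel, subtracting suitable multiples of \<open>b2\<close>
  from the multiples of \<open>b1\<close> would give infinitely many lattice vectors no longer than
  \<open>b2\<close>.\<close>

lemma lattice_det_nonzero: "lattice_det \<noteq> 0"
proof
  assume d: "lattice_det = 0"
  have "b2 \<noteq> 0" using lat_inj[of "(0, 0)" "(0, 1)"] by (auto simp: lattice_vec_def)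
  define s where "s = Re (b1 / b2)"
  have "Im (b1 / b2) = 0" using d by (simp add: lattice_det_def Im_divide Im_complex_div_eq_0)
  then have "b1 / b2 = of_real s" by (simp add: s_def complex_eq_iff)
  then have b1: "b1 = of_real s * b2" using \<open>b2 \<noteq> 0\<close> by (simp add: field_simps)
  have "norm (lat (i, - \<lfloor>of_int i * s\<rfloor>)) \<le> norm b2" for i
  proof -
    have "lat (i, - \<lfloor>of_int i * s\<rfloor>) = of_real (frac (of_int i * s)) * b2"
      by (simp add: lattice_vec_def b1 frac_def algebra_simps)
    then have "norm (lat (i, - \<lfloor>of_int i * s\<rfloor>)) = frac (of_int i * s) * norm b2"
      by (simp add: norm_mult frac_ge_0)
    also have "\<dots> \<le> 1 * norm b2" using frac_lt_1[of "of_int i * s"] by (intro mult_right_mono) auto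
    finally show ?thesis by simp
  qed
  then have "(\<lambda>i. (i, - \<lfloor>of_int i * s\<rfloor>)) ` UNIV \<subseteq> {\<beta>. norm (lat \<beta>) \<le> norm b2}" by auto
  then have "finite ((\<lambda>i::int. (i, - \<lfloor>of_int i * s\<rfloor>)) ` UNIV)" using finite_short_lattice_vectors finite_subset by blast
  then have "finite (UNIV :: int set)" by (rule finite_imageD) (auto intro: inj_onI)
  then show False by simp
qed

text \<open>Coordinates in the lattice basis, by Cramer's rule; their integer parts number the
  translates of the fundamental parallelogram.\<close>

definition coord1 :: "complex \<Rightarrow> real" where "coord1 z = Im (z * cnj b2) / lattice_det"
definition coord2 :: "complex \<Rightarrow> real" where "coord2 z = - Im (z * cnj b1) / lattice_det"

lemma coords: "z = of_real (coord1 z) * b1 + of_real (coord2 z) * b2"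
proof -
  have "of_real lattice_det * z = of_real (Im (z * cnj b2)) * b1 - of_real (Im (z * cnj b1)) * b2"
    by (auto simp: complex_eq_iff lattice_det_def algebra_simps)
  then have "z = (of_real (Im (z * cnj b2)) * b1 - of_real (Im (z * cnj b1)) * b2) / of_real lattice_det"
    using lattice_det_nonzero by (metis nonzero_mult_div_cancel_left of_real_eq_0_iff)
  also have "\<dots> = of_real (coord1 z) * b1 + of_real (coord2 z) * b2"
    by (simp only: coord1_def coord2_def diff_divide_distrib of_real_divide of_real_minus times_divide_eq_left
        minus_divide_left[symmetric] mult_minus_left add_uminus_conv_diff)
  finally show ?thesis .
qed

lemma coord_lat: "coord1 (z + lat (i, j)) = coord1 z + of_int i" "coord2 (z + lat (i, j)) = coord2 z + of_int j"
proof -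
  have "Im ((z + lat (i, j)) * cnj b2) = Im (z * cnj b2) + of_int i * lattice_det"
    "Im ((z + lat (i, j)) * cnj b1) = Im (z * cnj b1) - of_int j * lattice_det"
    by (simp_all add: lattice_vec_def lattice_det_def algebra_simps)
  then show "coord1 (z + lat (i, j)) = coord1 z + of_int i" "coord2 (z + lat (i, j)) = coord2 z + of_int j"
    using lattice_det_nonzero unfolding coord1_def coord2_def by (simp_all add: field_simps)
qed

definition cell1 :: "complex \<Rightarrow> int" where "cell1 z = \<lfloor>coord1 z\<rfloor>"
definition cell2 :: "complex \<Rightarrow> int" where "cell2 z = \<lfloor>coord2 z\<rfloor>"

lemma cell_lat [simp]: "cell1 (z + lat (i, j)) = cell1 z + i" "cell2 (z + lat (i, j)) = cell2 z + j"
  by (simp_all add: cell1_def cell2_def coord_lat)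

lemma cell_lat_diff [simp]: "cell1 (z - lat (i, j)) = cell1 z - i" "cell2 (z - lat (i, j)) = cell2 z - j"
  using cell_lat[of z "- i" "- j"] by (simp_all add: lat_uminus)

definition base_cell where "base_cell = {v \<in> tiling_vertices T. cell1 v = 0 \<and> cell2 v = 0}"

lemma finite_base_cell: "finite base_cell"
proof -
  have "norm z \<le> norm b1 + norm b2" if "cell1 z = 0" "cell2 z = 0" for z
  proof -
    have c: "0 \<le> coord1 z" "coord1 z \<le> 1" "0 \<le> coord2 z" "coord2 z \<le> 1"
      using that unfolding cell1_def cell2_def by linarith+
    have "norm z \<le> norm (of_real (coord1 z) * b1) + norm (of_real (coord2 z) * b2)"
      by (subst coords) (rule norm_triangle_ineq)
    also have "\<dots> \<le> 1 * norm b1 + 1 * norm b2"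
      unfolding norm_mult using c by (intro add_mono mult_right_mono) auto
    finally show ?thesis by simp
  qed
  then have "base_cell \<subseteq> tiling_vertices T \<inter> cball 0 (norm b1 + norm b2)" by (auto simp: base_cell_def)
  then show ?thesis using finite_vertices_bounded finite_subset by blast
qed

lemma to_base_cell: "v \<in> tiling_vertices T \<Longrightarrow> v - lat (cell1 v, cell2 v) \<in> base_cell"
  using vertex_translate[of v "(- cell1 v, - cell2 v)"] by (simp add: base_cell_def lat_uminus)

lemma finite_neighbours: "v \<in> tiling_vertices T \<Longrightarrow> finite {w. tiling_adj T v w}"
proof -
  assume "v \<in> tiling_vertices T"
  then obtain d L where "star v d L" using star_exists by blast
  then show ?thesis using star_neighbours by simp
qed

lemma finite_cells:
  assumes "finite B"
  shows "finite {v \<in> tiling_vertices T. (cell1 v, cell2 v) \<in> B}"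
    and "card {v \<in> tiling_vertices T. (cell1 v, cell2 v) \<in> B} \<le> card B * card base_cell"
proof -
  have sub: "{v \<in> tiling_vertices T. (cell1 v, cell2 v) \<in> B} \<subseteq> (\<lambda>(\<beta>, q). q + lat \<beta>) ` (B \<times> base_cell)"
  proof
    fix v assume v: "v \<in> {v \<in> tiling_vertices T. (cell1 v, cell2 v) \<in> B}"
    then show "v \<in> (\<lambda>(\<beta>, q). q + lat \<beta>) ` (B \<times> base_cell)"
      using to_base_cell[of v] by (intro image_eqI[of _ _ "((cell1 v, cell2 v), v - lat (cell1 v, cell2 v))"]) auto
  qed
  have fin: "finite (B \<times> base_cell)" using assms finite_base_cell by simp
  then show "finite {v \<in> tiling_vertices T. (cell1 v, cell2 v) \<in> B}" using sub finite_subset by blast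
  have "card {v \<in> tiling_vertices T. (cell1 v, cell2 v) \<in> B} \<le> card ((\<lambda>(\<beta>, q). q + lat \<beta>) ` (B \<times> base_cell))"
    using sub fin by (intro card_mono) auto
  also have "\<dots> \<le> card (B \<times> base_cell)" using fin by (rule card_image_le)
  finally show "card {v \<in> tiling_vertices T. (cell1 v, cell2 v) \<in> B} \<le> card B * card base_cell"
    by (simp add: card_cartesian_product)
qed

text \<open>By periodicity only the finitely many edges at the base cell matter. The number
  \<open>c\<close> is the range of the operator, measured in cells.\<close>

lemma adjacent_cells_bounded:
  obtains c :: nat where
    "\<And>v w. tiling_adj T v w \<Longrightarrow> v \<in> tiling_vertices T \<Longrightarrow>
        \<bar>cell1 w - cell1 v\<bar> \<le> int c \<and> \<bar>cell2 w - cell2 v\<bar> \<le> int c"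
proof -
  define M where "M = (\<Union>q\<in>base_cell. (\<lambda>w. nat (max \<bar>cell1 w\<bar> \<bar>cell2 w\<bar>)) ` {w. tiling_adj T q w})"
  have "finite M" unfolding M_def
    by (intro finite_UN_I finite_base_cell finite_imageI finite_neighbours) (simp add: base_cell_def)
  then obtain c where c: "\<And>x. x \<in> M \<Longrightarrow> x \<le> c" by (meson finite_nat_set_iff_bounded_le)
  show thesis
  proof (rule that[of c])
    fix v w assume vw: "tiling_adj T v w" "v \<in> tiling_vertices T"
    let ?l = "lat (cell1 v, cell2 v)"
    have "tiling_adj T (v - ?l) (w - ?l)" using adj_translate[OF vw(1), of "(- cell1 v, - cell2 v)"] by (simp add: lat_uminus)
    then have "nat (max \<bar>cell1 (w - ?l)\<bar> \<bar>cell2 (w - ?l)\<bar>) \<in> M" using to_base_cell[OF vw(2)] unfolding M_def by blast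
    then have "nat (max \<bar>cell1 w - cell1 v\<bar> \<bar>cell2 w - cell2 v\<bar>) \<le> c" using c by simp
    then show "\<bar>cell1 w - cell1 v\<bar> \<le> int c \<and> \<bar>cell2 w - cell2 v\<bar> \<le> int c" by (simp add: nat_le_iff)
  qed
qed

text \<open>Discrete Fourier inversion: summing over the \<open>N\<close> by \<open>N\<close>
  translates of \<open>v\<close> against the conjugate character of \<open>i0\<close> leaves only
  the term of \<open>i0\<close>.\<close>

lemma bloch_independent:
  fixes a :: "nat \<times> nat \<Rightarrow> complex"
  assumes N: "N \<ge> 2" and I: "I = {..<N} \<times> {..<N}"
    and f: "\<And>i. i \<in> I \<Longrightarrow> f i \<in> bloch_space T b1 b2 (2 * pi * real (fst i) / real N, 2 * pi * real (snd i) / real N)"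
    and zero: "\<And>v. v \<in> tiling_vertices T \<Longrightarrow> (\<Sum>i\<in>I. a i * f i v) = 0"
    and i0: "i0 \<in> I" and v: "v \<in> tiling_vertices T" "f i0 v \<noteq> 0"
  shows "a i0 = 0"
proof -
  let ?th = "\<lambda>p. 2 * pi * real p / real N"
  let ?ch = "\<lambda>p k. cis (?th p * real k)" and ?cc = "\<lambda>p k. cis (- (?th p * real k))"
  obtain p0 q0 where i0': "i0 = (p0, q0)" "p0 < N" "q0 < N" using i0 I by auto
  have bl: "f (p, q) (v + lat (int k, int l)) = ?ch p k * ?ch q l * f (p, q) v" if "(p, q) \<in> I" for p q k l
    using f[OF that] v(1) by (auto simp: bloch_space_def lattice_shift_def cis_mult dest!: bspec spec[of _ "(int k, int l)"])
  have "0 = (\<Sum>k<N. \<Sum>l<N. ?cc p0 k * ?cc q0 l * (\<Sum>i\<in>I. a i * f i (v + lat (int k, int l))))"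
    using zero[OF vertex_translate[OF v(1)]] by simp
  also have "\<dots> = (\<Sum>k<N. \<Sum>l<N. \<Sum>i\<in>I. a i * f i v * ((?ch (fst i) k * ?cc p0 k) * (?ch (snd i) l * ?cc q0 l)))"
    unfolding sum_distrib_left using bl by (intro sum.cong refl) (auto simp: mult_ac)
  also have "\<dots> = (\<Sum>k<N. \<Sum>i\<in>I. \<Sum>l<N. a i * f i v * ((?ch (fst i) k * ?cc p0 k) * (?ch (snd i) l * ?cc q0 l)))"
    by (intro sum.cong refl sum.swap)
  also have "\<dots> = (\<Sum>i\<in>I. \<Sum>k<N. \<Sum>l<N. a i * f i v * ((?ch (fst i) k * ?cc p0 k) * (?ch (snd i) l * ?cc q0 l)))"
    by (rule sum.swap)
  also have "\<dots> = (\<Sum>i\<in>I. a i * f i v * ((\<Sum>k<N. ?ch (fst i) k * ?cc p0 k) * (\<Sum>l<N. ?ch (snd i) l * ?cc q0 l)))"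
    by (intro sum.cong refl, subst sum_product) (simp only: sum_distrib_left)
  also have "\<dots> = (\<Sum>i\<in>I. if i = i0 then a i0 * f i0 v * of_nat (N * N) else 0)"
  proof (intro sum.cong refl)
    fix i assume "i \<in> I"
    then obtain p q where i: "i = (p, q)" "p < N" "q < N" using I by auto
    show "a i * f i v * ((\<Sum>k<N. ?ch (fst i) k * ?cc p0 k) * (\<Sum>l<N. ?ch (snd i) l * ?cc q0 l))
      = (if i = i0 then a i0 * f i0 v * of_nat (N * N) else 0)"
      using character_orthogonality[OF N i(2) i0'(2)] character_orthogonality[OF N i(3) i0'(3)]
      by (auto simp: i(1) i0'(1))
  qed
  also have "\<dots> = a i0 * f i0 v * of_nat (N * N)" using i0 I by simp
  finally show ?thesis using v(2) N by simp
qed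

text \<open>The Bloch functions with \<open>\<theta> \<in> (2\<pi>/N)\<int>\<^sup>2\<close> span an \<open>N\<^sup>2\<close>-dimensional space of \<open>N\<close>-periodic eigenfunctions.
  Vanishing on the boundary layer of the \<open>N \<times> N\<close> box costs only \<open>O(N)\<close> linear conditions; a nonzero
  eigenfunction satisfying them can be cut off outside the box.\<close>

lemma finite_support_eigenfunction:
  fixes \<gamma> :: "complex \<Rightarrow> complex \<Rightarrow> real" and E :: complex
  assumes flat: "flat_eigenvalue T b1 b2 \<gamma> E"
  obtains h where "finite {v \<in> tiling_vertices T. h v \<noteq> 0}" "\<exists>v\<in>tiling_vertices T. h v \<noteq> 0"
    "\<And>v. v \<in> tiling_vertices T \<Longrightarrow> (\<Sum>w | tiling_adj T v w. of_real (\<gamma> v w) * h w) = E * h v"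
proof -
  let ?V = "tiling_vertices T"
  obtain c where c: "\<And>v w. tiling_adj T v w \<Longrightarrow> v \<in> ?V \<Longrightarrow>
        \<bar>cell1 w - cell1 v\<bar> \<le> int c \<and> \<bar>cell2 w - cell2 v\<bar> \<le> int c"
    using adjacent_cells_bounded by blast
  define q where "q = card base_cell"
  \<comment> \<open>Large enough that the boundary layer, with at most \<open>4 * c * N * q\<close>
    vertices, imposes fewer conditions than there are Bloch functions, namely
    \<open>N * N\<close>.\<close>
  define N where "N = 4 * c * q + 2 * c + 2"
  have N2: "N \<ge> 2" "2 * c < N" by (auto simp: N_def)
  define I where "I = {..<N} \<times> {..<N}"
  define th where "th i = (2 * pi * real (fst i) / real N, 2 * pi * real (snd i) / real N)" for i :: "nat \<times> nat"
  have "\<exists>f\<in>bloch_space T b1 b2 (th i). (\<exists>v\<in>?V. f v \<noteq> 0) \<and>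
     (\<forall>v\<in>?V. (\<Sum>w | tiling_adj T v w. of_real (\<gamma> v w) * f w) = E * f v)" for i
    using flat by (simp only: flat_eigenvalue_def)
  then obtain f where f: "\<And>i. f i \<in> bloch_space T b1 b2 (th i)" "\<And>i. \<exists>v\<in>?V. f i v \<noteq> 0"
    "\<And>i v. v \<in> ?V \<Longrightarrow> (\<Sum>w | tiling_adj T v w. of_real (\<gamma> v w) * f i w) = E * f i v"
    by metis
  define box where "box = {0..<int N} \<times> {0..<int N}"
  define core where "core = {int c..<int N - int c} \<times> {int c..<int N - int c}"
  have cb: "core \<subseteq> box" using N2 by (auto simp: box_def core_def)
  define X where "X = {v \<in> ?V. (cell1 v, cell2 v) \<in> box - core}"
  have fX: "finite X" "card X \<le> card (box - core) * q"
    using finite_cells[of "box - core"] by (auto simp: X_def q_def box_def)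
  have "card (box - core) = N * N - (N - 2 * c) * (N - 2 * c)"
  proof -
    have "nat (int N - int c - int c) = N - 2 * c" by simp
    then have "card core = (N - 2 * c) * (N - 2 * c)" by (simp add: core_def card_cartesian_product)
    moreover have "card box = N * N" by (simp add: box_def card_cartesian_product)
    ultimately show ?thesis using card_Diff_subset[OF _ cb] by (simp add: core_def)
  qed
  also have "\<dots> \<le> 4 * c * N"
  proof -
    obtain r where r: "N = r + 2 * c" using N2 by (metis add.commute le_add_diff_inverse less_imp_le)
    have "N * N = r * r + 4 * c * r + 4 * c * c" by (simp add: r algebra_simps)
    also have "\<dots> \<le> r * r + 4 * c * N" by (simp add: r algebra_simps)
    finally show ?thesis by (simp add: r)
  qed
  finally have "card X \<le> (4 * c * N) * q" using fX(2) by (meson le_trans mult_le_mono1)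
  also have "\<dots> = (4 * c * q) * N" by simp
  also have "\<dots> < N * N" using N2 by (intro mult_strict_right_mono) (auto simp: N_def)
  finally have "card X < card I" by (simp add: I_def card_cartesian_product)
  then obtain a where a: "\<exists>i\<in>I. a i \<noteq> 0" "\<forall>x\<in>X. (\<Sum>i\<in>I. a i * f i x) = 0"
    using underdetermined_system[of X I f] fX(1) by (auto simp: I_def)
  define G where "G v = (\<Sum>i\<in>I. a i * f i v)" for v
  have G0: "G v = 0" if "v \<in> X" for v using a(2) that by (simp add: G_def)
  have Geq: "(\<Sum>w | tiling_adj T v w. of_real (\<gamma> v w) * G w) = E * G v" if "v \<in> ?V" for v
  proof -
    have "(\<Sum>w | tiling_adj T v w. of_real (\<gamma> v w) * G w) = (\<Sum>w | tiling_adj T v w. \<Sum>i\<in>I. a i * (of_real (\<gamma> v w) * f i w))"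
      by (simp add: G_def sum_distrib_left mult_ac)
    also have "\<dots> = (\<Sum>i\<in>I. \<Sum>w | tiling_adj T v w. a i * (of_real (\<gamma> v w) * f i w))" by (rule sum.swap)
    also have "\<dots> = (\<Sum>i\<in>I. a i * (E * f i v))" using f(3)[OF that] by (simp add: sum_distrib_left[symmetric])
    finally show ?thesis by (simp add: G_def sum_distrib_left mult_ac)
  qed
  have per: "G (v - lat (int N * k, int N * l)) = G v" if "v \<in> ?V" for v k l
  proof -
    have "f i (v + lat (- (int N * k), - (int N * l))) = f i v" for i
    proof -
      have "2 * pi * real (fst i) / real N * of_int (- (int N * k)) + 2 * pi * real (snd i) / real N * of_int (- (int N * l))
        = 2 * pi * of_int (- (int (fst i) * k + int (snd i) * l))"
        using N2 by (simp add: field_simps)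
      then have "cis (2 * pi * real (fst i) / real N * of_int (- (int N * k)) + 2 * pi * real (snd i) / real N * of_int (- (int N * l))) = 1"
        by (metis cis_multiple_2pi Ints_of_int)
      then show ?thesis using f(1)[of i] that
        by (auto simp: bloch_space_def lattice_shift_def th_def dest!: bspec spec[of _ "(- (int N * k), - (int N * l))"])
    qed
    then show ?thesis by (simp add: G_def lat_uminus)
  qed
  have outside: "G w = 0" if w: "w \<in> ?V" and "(cell1 w mod int N, cell2 w mod int N) \<notin> core" for w
  proof -
    define w' where "w' = w - lat (int N * (cell1 w div int N), int N * (cell2 w div int N))"
    have "w' \<in> ?V" using vertex_translate[OF w, of "(- (int N * (cell1 w div int N)), - (int N * (cell2 w div int N)))"]
      by (simp add: w'_def lat_uminus)
    moreover have "cell1 w' = cell1 w mod int N" "cell2 w' = cell2 w mod int N"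
      by (simp_all add: w'_def minus_mult_div_eq_mod)
    ultimately have "w' \<in> X" using that(2) N2 by (auto simp: X_def box_def)
    then show ?thesis using G0 per[OF w] unfolding w'_def by metis
  qed
  \<comment> \<open>The cut preserves the equation: within distance \<open>c\<close> of the box,
    \<open>G\<close> vanishes off the core, by the conditions on the layer together with
    periodicity.\<close>
  define h where "h v = (if (cell1 v, cell2 v) \<in> core then G v else 0)" for v
  show thesis
  proof (rule that[of h])
    have "{v \<in> ?V. h v \<noteq> 0} \<subseteq> {v \<in> ?V. (cell1 v, cell2 v) \<in> core}" by (auto simp: h_def)
    moreover have "finite core" by (simp add: core_def)
    ultimately show "finite {v \<in> ?V. h v \<noteq> 0}" using finite_cells(1) finite_subset by blast
  next
    obtain i0 where i0: "i0 \<in> I" "a i0 \<noteq> 0" using a(1) by blast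
    obtain v0 where "v0 \<in> ?V" "f i0 v0 \<noteq> 0" using f(2) by blast
    then have "\<exists>v\<in>?V. G v \<noteq> 0"
      using bloch_independent[OF N2(1) I_def, of f a i0 v0] f(1) i0 by (auto simp: th_def G_def)
    then obtain v where v: "v \<in> ?V" "G v \<noteq> 0" by blast
    define v' where "v' = v - lat (int N * (cell1 v div int N), int N * (cell2 v div int N))"
    have "v' \<in> ?V" using vertex_translate[OF v(1), of "(- (int N * (cell1 v div int N)), - (int N * (cell2 v div int N)))"]
      by (simp add: v'_def lat_uminus)
    moreover have "cell1 v' = cell1 v mod int N" "cell2 v' = cell2 v mod int N"
      by (simp_all add: v'_def minus_mult_div_eq_mod)
    moreover have "(cell1 v mod int N, cell2 v mod int N) \<in> core" using outside[OF v(1)] v(2) by blast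
    moreover have "G v' \<noteq> 0" using per[OF v(1)] v(2) by (simp add: v'_def)
    ultimately show "\<exists>v\<in>?V. h v \<noteq> 0" by (intro bexI[of _ v']) (auto simp: h_def)
  next
    fix v assume v: "v \<in> ?V"
    show "(\<Sum>w | tiling_adj T v w. of_real (\<gamma> v w) * h w) = E * h v"
    proof (cases "(cell1 v, cell2 v) \<in> box")
      case True
      have "h w = G w" if "tiling_adj T v w" for w
      proof (cases "(cell1 w, cell2 w) \<in> core")
        case False
        \<comment> \<open>A step of length at most \<open>c\<close> from the box that misses the
          core also misses the periodic copies of the core.\<close>
        have *: "y mod int N \<notin> {int c..<int N - int c}"
          if y: "x \<in> {0..<int N}" "\<bar>y - x\<bar> \<le> int c" "y \<notin> {int c..<int N - int c}" for x y
        proof -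
          consider "y < 0" | "0 \<le> y" "y < int N" | "y \<ge> int N" by linarith
          then show ?thesis
          proof cases
            case 1
            then have "(y + int N) mod int N = y + int N" using y N2 by (intro mod_pos_pos_trivial) auto
            then have "y mod int N = y + int N" by simp
            then show ?thesis using 1 y N2 by auto
          next
            case 2
            then show ?thesis using y by simp
          next
            case 3
            then have "(y - int N) mod int N = y - int N" using y N2 by (intro mod_pos_pos_trivial) auto
            then have "y mod int N = y - int N" by simp
            then show ?thesis using 3 y N2 by auto
          qed
        qed
        have "(cell1 w mod int N, cell2 w mod int N) \<notin> core"
          using False True c[OF \<open>tiling_adj T v w\<close> v] *[of "cell1 v" "cell1 w"] *[of "cell2 v" "cell2 w"]
          unfolding core_def box_def by blast
        then show ?thesis using outside[OF adjacent_is_vertex[OF that]] False by (simp add: h_def)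
      qed (simp add: h_def)
      moreover have "h v = G v"
        using G0[of v] v True by (auto simp: h_def X_def)
      ultimately show ?thesis using Geq[OF v] by simp
    next
      case False
      have "h w = 0" if "tiling_adj T v w" for w
      proof -
        have "(cell1 w, cell2 w) \<notin> core" using False c[OF that v] by (auto simp: core_def box_def)
        then show ?thesis by (simp add: h_def)
      qed
      moreover have "h v = 0" using False cb by (auto simp: h_def)
      ultimately show ?thesis by simp
    qed
  qed
qed

end

section \<open>Peeling certificates\<close>

text \<open>A position \<open>(a, b, c, d)\<close> stands for \<open>a + b\<zeta> + c\<zeta>\<^sup>2 + d\<zeta>\<^sup>3\<close>, where \<open>\<zeta>\<close> is a primitive \<open>m\<close>-th root of unity
  with \<open>\<zeta>\<^sup>4 = s\<zeta>\<^sup>2 - 1\<close>: \<open>s = 1\<close> for \<open>m = 12\<close> and \<open>s = 0\<close> for \<open>m = 8\<close>. A label \<open>(c, k, L)\<close> says that \<open>L\<close> lists the tiles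
  at \<open>c\<close> counterclockwise, starting to the left of the edge in direction \<open>\<zeta>^k\<close>.\<close>

type_synonym pos = "int \<times> int \<times> int \<times> int"
type_synonym label = "pos \<times> nat \<times> nat list"

fun add_pos :: "pos \<Rightarrow> pos \<Rightarrow> pos" where
  "add_pos (a, b, c, d) (a', b', c', d') = (a + a', b + b', c + c', d + d')"

text \<open>The cyclotomic polynomials of orders 12 and 8 are x^4 - x^2 + 1 and x^4 + 1; having the
  same degree, they share one coordinate format.\<close>

fun zeta_times :: "int \<Rightarrow> pos \<Rightarrow> pos" where
  "zeta_times s (a, b, c, d) = (- d, a, b + s * d, c)"

definition zeta_power :: "int \<Rightarrow> nat \<Rightarrow> pos" where
  "zeta_power s k = (zeta_times s ^^ k) (1, 0, 0, 0)"

text \<open>The first argument holds the heights of \<open>1, \<zeta>, \<zeta>\<^sup>2, \<zeta>\<^sup>3\<close> rounded to integers; the right-hand side absorbs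
  the rounding errors.\<close>

fun upward :: "pos \<Rightarrow> pos \<Rightarrow> bool" where
  "upward (p, q, r, t) (a, b, c, d) \<longleftrightarrow> p * a + q * b + r * c + t * d > \<bar>a\<bar> + \<bar>b\<bar> + \<bar>c\<bar> + \<bar>d\<bar>"

text \<open>Interior angle in steps of 2\<pi>/m; the division is exact for the polygons that
  occur.\<close>

definition angle_units :: "nat \<Rightarrow> nat \<Rightarrow> nat" where
  "angle_units m n = (m * (n - 2)) div (2 * n)"

text \<open>Going once around a vertex, each entry is an edge direction with the vertex figure
  reread from that edge.\<close>

fun spin :: "nat \<Rightarrow> nat \<Rightarrow> nat \<Rightarrow> nat list \<Rightarrow> (nat \<times> nat list) list" where
  "spin m 0 k L = []"
| "spin m (Suc i) k L = (k, L) # spin m i ((k + angle_units m (hd L)) mod m) (rotate1 L)"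

definition spokes :: "nat \<Rightarrow> nat \<Rightarrow> nat list \<Rightarrow> (nat \<times> nat list) list" where
  "spokes m k L = spin m (length L) k L"

definition opposite :: "nat \<Rightarrow> nat \<Rightarrow> nat" where
  "opposite m k = (k + m div 2) mod m"

definition matches :: "nat list \<Rightarrow> nat list \<Rightarrow> bool" where
  "matches M M' \<longleftrightarrow> hd M' = last M \<and> last M' = hd M"

fun neighbour_positions :: "nat \<Rightarrow> int \<Rightarrow> label \<Rightarrow> pos list" where
  "neighbour_positions m s (c, k, L) = map (\<lambda>(k', M). add_pos c (zeta_power s k')) (spokes m k L)"

definition known_zero :: "pos \<Rightarrow> pos list \<Rightarrow> pos \<Rightarrow> bool" where
  "known_zero H Z c \<longleftrightarrow> upward H c \<or> c \<in> set Z"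

text \<open>If the rule does not apply, \<open>Z\<close> is returned unchanged, so a wrong script
  can only fail.\<close>

definition peel :: "nat \<Rightarrow> int \<Rightarrow> pos \<Rightarrow> pos list \<Rightarrow> label \<Rightarrow> pos list" where
  "peel m s H Z l =
     (if known_zero H Z (fst l) then
        (case filter (\<lambda>x. \<not> known_zero H Z x) (neighbour_positions m s l) of [x] \<Rightarrow> x # Z | _ \<Rightarrow> Z)
      else Z)"

text \<open>Two labels contradict each other if an edge of one ends at the other without being one of its edges,
  or with different tiles on its sides.\<close>

fun fits :: "nat \<Rightarrow> int \<Rightarrow> label \<Rightarrow> label \<Rightarrow> bool" where
  "fits m s (c, k, L) (c', k', L') \<longleftrightarrow>
     (\<forall>x \<in> set (spokes m k L). add_pos c (zeta_power s (fst x)) = c' \<longrightarrow>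
        (\<exists>y \<in> set (spokes m k' L'). fst y = opposite m (fst x) \<and> matches (snd x) (snd y)))"

definition crossings :: "nat \<Rightarrow> int \<Rightarrow> nat list list \<Rightarrow> label \<Rightarrow> nat \<Rightarrow> label list" where
  "crossings m s cls l j =
     (case l of (c, k, L) \<Rightarrow> case spokes m k L ! j of (k', M) \<Rightarrow>
        map (\<lambda>M'. (add_pos c (zeta_power s k'), opposite m k', M')) (filter (matches M) cls))"

text \<open>Candidates are discarded only if they contradict an established label; the comparison
  runs both ways because \<open>fits\<close> looks along the edges of its first label.\<close>

definition branches :: "nat \<Rightarrow> int \<Rightarrow> nat list list \<Rightarrow> label list \<Rightarrow> nat \<Rightarrow> nat \<Rightarrow> label list" where
  "branches m s cls ls i j =
     filter (\<lambda>l. \<forall>x \<in> set ls. fits m s x l \<and> fits m s l x) (crossings m s cls (ls ! i) j)"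

text \<open>\<open>Explore i j\<close> crosses the \<open>j\<close>-th edge of the \<open>i\<close>-th label; the pattern at the new vertex need not be
  determined by the two tiles at that edge, and there is one script for each pattern that fits.
  \<open>Peel js\<close> applies the peeling rule at the listed labels until the origin is known to be a zero.\<close>

datatype script = Peel "nat list" | Explore nat nat "script list"

text \<open>Scripts are paired with the surviving candidates in the order of
  \<open>branches\<close>. A candidate without a script makes the check fail; an exploration without
  candidates succeeds, since it cannot occur in a tiling.\<close>

fun check :: "nat \<Rightarrow> int \<Rightarrow> pos \<Rightarrow> nat list list \<Rightarrow> label list \<Rightarrow> script \<Rightarrow> bool"
  and check_all :: "nat \<Rightarrow> int \<Rightarrow> pos \<Rightarrow> nat list list \<Rightarrow> label list \<Rightarrow> label list \<Rightarrow> script list \<Rightarrow> bool"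
where
  "check m s H cls ls (Peel js) \<longleftrightarrow> list_all (\<lambda>j. j < length ls) js \<and>
     (0, 0, 0, 0) \<in> set (foldl (\<lambda>Z j. peel m s H Z (ls ! j)) [] js)"
| "check m s H cls ls (Explore i j ss) \<longleftrightarrow> i < length ls \<and> j < length (snd (snd (ls ! i))) \<and>
     check_all m s H cls ls (branches m s cls ls i j) ss"
| "check_all m s H cls ls [] ss \<longleftrightarrow> True"
| "check_all m s H cls ls (b # bs) [] \<longleftrightarrow> False"
| "check_all m s H cls ls (b # bs) (t # ts) \<longleftrightarrow> check m s H cls (ls @ [b]) t \<and> check_all m s H cls ls bs ts"

definition config_list :: "nat list \<Rightarrow> nat list list" where
  "config_list cfg = remdups (map (\<lambda>k. rotate k cfg) [0..<length cfg] @ map (\<lambda>k. rotate k (rev cfg)) [0..<length cfg])"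

lemma config_class_list:
  assumes "L \<in> config_class cfg" "cfg \<noteq> []" shows "L \<in> set (config_list cfg)"
proof -
  have "\<exists>j<length xs. rotate k xs = rotate j xs" if "xs \<noteq> []" for k and xs :: "nat list"
    using that by (intro exI[of _ "k mod length xs"]) (simp add: rotate_conv_mod[symmetric])
  note * = this
  from assms(1) obtain k where "L = rotate k cfg \<or> L = rotate k (rev cfg)" by (auto simp: config_class_def)
  then obtain j where "j < length cfg" "L = rotate j cfg \<or> L = rotate j (rev cfg)"
    using *[of cfg k] *[of "rev cfg" k] assms(2) by (metis length_rev rev_is_Nil_conv)
  then show ?thesis by (auto simp: config_list_def)
qed

lemma length_spin [simp]: "length (spin m i k L) = i"
  by (induction m i k L rule: spin.induct) auto

lemma spin_snd: "j < i \<Longrightarrow> snd (spin m i k L ! j) = rotate j L"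
proof (induction m i k L arbitrary: j rule: spin.induct)
  case (2 m i k L)
  then show ?case by (cases j) (auto simp: rotate1_rotate_swap)
qed simp

section \<open>Geometric meaning of positions and labels\<close>

definition height :: "real \<Rightarrow> real \<Rightarrow> complex \<Rightarrow> real" where
  "height A B z = A * Re z + B * Im z"

text \<open>Since \<open>g\<close> divides all angles and the half turn, measured in steps,
  directions that start from a multiple of \<open>g\<close> remain multiples of \<open>g\<close>;
  only \<open>m div g\<close> orientations need a script.\<close>

locale lattice_directions = archimedean +
  fixes m g :: nat and s :: int
  assumes m: "even m" "m > 0"
    and zeta4: "cis (2 * pi / real m) ^ 4 = of_int s * cis (2 * pi / real m) ^ 2 - 1"
    and units: "\<And>n. n \<in> set cfg \<Longrightarrow> interior_angle n = 2 * pi * real (angle_units m n) / real m"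
    and g: "g dvd m div 2" "\<And>n. n \<in> set cfg \<Longrightarrow> g dvd angle_units m n"
begin

definition zeta :: complex where "zeta = cis (2 * pi / real m)"

fun pos_val :: "pos \<Rightarrow> complex" where
  "pos_val (a, b, c, d) = of_int a + of_int b * zeta + of_int c * zeta ^ 2 + of_int d * zeta ^ 3"

lemma pos_val_add [simp]: "pos_val (add_pos x y) = pos_val x + pos_val y"
  by (cases x; cases y) (simp add: algebra_simps)

lemma pos_val_zeta_times [simp]: "pos_val (zeta_times s x) = zeta * pos_val x"
proof (cases x)
  case (fields a b c d)
  have "zeta * zeta ^ 3 = of_int s * zeta ^ 2 - 1"
    using zeta4 by (simp add: zeta_def power_Suc[symmetric] del: power_Suc)
  then have "of_int d * (zeta * zeta ^ 3) = of_int d * (of_int s * zeta ^ 2 - 1)" by simp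
  then show ?thesis unfolding fields by (simp add: algebra_simps power2_eq_square power3_eq_cube)
qed

lemma pos_val_zeta_power [simp]: "pos_val (zeta_power s k) = zeta ^ k"
proof -
  have "pos_val ((zeta_times s ^^ k) (1, 0, 0, 0)) = zeta ^ k" by (induction k) auto
  then show ?thesis by (simp add: zeta_power_def)
qed

lemma zeta_m: "zeta ^ m = 1"
  using m by (simp add: zeta_def Complex.DeMoivre)

lemma zeta_half: "zeta ^ (m div 2) = -1"
proof -
  have "real (m div 2) * (2 * pi / real m) = pi" using m by (auto simp: real_of_nat_div)
  then show ?thesis by (simp add: zeta_def Complex.DeMoivre)
qed

lemma zeta_mod: "zeta ^ (k mod m) = zeta ^ k"
proof -
  have "zeta ^ k = zeta ^ (m * (k div m) + k mod m)" by simp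
  also have "\<dots> = zeta ^ (k mod m)" by (simp only: power_add power_mult zeta_m power_one mult_1)
  finally show ?thesis by simp
qed

lemma zeta_opposite: "zeta ^ opposite m k = - (zeta ^ k)"
  by (simp add: opposite_def zeta_mod power_add zeta_half)

lemma zeta_angle: "n \<in> set cfg \<Longrightarrow> zeta ^ angle_units m n = cis (interior_angle n)"
  using units[of n] by (simp add: zeta_def Complex.DeMoivre mult.commute)

definition place :: "complex \<Rightarrow> complex \<Rightarrow> pos \<Rightarrow> complex" where
  "place v e c = v + e * pos_val c"

fun valid :: "complex \<Rightarrow> complex \<Rightarrow> label \<Rightarrow> bool" where
  "valid v e (c, k, L) \<longleftrightarrow> star (place v e c) (e * zeta ^ k) L"

text \<open>This property passes to neighbours, so the aligned vertices can replace the whole vertex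
  set in the search for a highest one.\<close>

definition aligned :: "complex \<Rightarrow> complex \<Rightarrow> bool" where
  "aligned e w \<longleftrightarrow> (\<exists>k L. g dvd k \<and> star w (e * zeta ^ k) L)"

lemma spin_star:
  "star w (e * zeta ^ k) L \<Longrightarrow> x \<in> set (spin m i k L) \<Longrightarrow>
     star w (e * zeta ^ fst x) (snd x) \<and> (g dvd k \<longrightarrow> g dvd fst x)"
proof (induction i arbitrary: k L)
  case (Suc i)
  have L: "L \<in> config_class cfg" using Suc.prems by (auto simp: star_def)
  then have h: "hd L \<in> set cfg" using config_class_set class_nonempty by (metis hd_in_set)
  have "star w (e * zeta ^ ((k + angle_units m (hd L)) mod m)) (rotate1 L)"
    using star_rotate1[OF Suc.prems(1)] by (simp add: zeta_mod power_add zeta_angle[OF h] mult.assoc)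
  moreover have "g dvd m" using g(1) m by (metis dvd_mult2 even_two_times_div_two dvd_triv_right dvd_trans)
  then have "g dvd k \<Longrightarrow> g dvd (k + angle_units m (hd L)) mod m" using g(2)[OF h] by (simp add: dvd_mod)
  ultimately show ?case using Suc by auto
qed simp

lemma spokes_star:
  assumes "star w (e * zeta ^ k) L" "x \<in> set (spokes m k L)"
  shows "star w (e * zeta ^ fst x) (snd x)" and "g dvd k \<Longrightarrow> g dvd fst x"
  using spin_star[OF assms(1)] assms(2) by (auto simp: spokes_def)

lemma spin_edge_vectors:
  "set L \<subseteq> set cfg \<Longrightarrow> map (\<lambda>x. e * zeta ^ fst x) (spin m (length L) k (L @ M)) = edge_vectors (e * zeta ^ k) L"
proof (induction L arbitrary: k M)
  case (Cons n L)
  have *: "e * zeta ^ ((k + angle_units m n) mod m) = e * zeta ^ k * cis (interior_angle n)"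
    using Cons.prems by (simp add: zeta_mod power_add zeta_angle mult.assoc)
  show ?case using Cons.IH[of "(k + angle_units m n) mod m" "M @ [n]", unfolded *] Cons.prems by simp
qed simp

lemma spokes_neighbours:
  assumes "star w (e * zeta ^ k) L"
  shows "{x. tiling_adj T w x} = (\<lambda>x. w + e * zeta ^ fst x) ` set (spokes m k L)"
proof -
  have "set L \<subseteq> set cfg" using assms config_class_set by (auto simp: star_def)
  from spin_edge_vectors[OF this, of e k "[]"] have "edge_vectors (e * zeta ^ k) L = map (\<lambda>x. e * zeta ^ fst x) (spokes m k L)"
    by (simp add: spokes_def)
  then show ?thesis using star_neighbours[OF assms] by (simp add: image_image)
qed

lemma spokes_cross:
  assumes "star w (e * zeta ^ k) L" "x \<in> set (spokes m k L)"
  obtains M where "star (w + e * zeta ^ fst x) (e * zeta ^ opposite m (fst x)) M" "matches (snd x) M"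
    "M \<in> config_class cfg"
proof -
  from star_cross[OF spokes_star(1)[OF assms]] obtain M
    where "star (w + e * zeta ^ fst x) (- (e * zeta ^ fst x)) M" "hd M = last (snd x)" "last M = hd (snd x)"
    by blast
  then show thesis by (intro that[of M]) (auto simp: zeta_opposite matches_def star_def)
qed

lemma aligned_neighbour:
  assumes "aligned e w" "tiling_adj T w x" shows "aligned e x"
proof -
  from assms(1) obtain k L where k: "g dvd k" "star w (e * zeta ^ k) L" by (auto simp: aligned_def)
  have "x \<in> (\<lambda>x. w + e * zeta ^ fst x) ` set (spokes m k L)" using spokes_neighbours[OF k(2)] assms(2) by blast
  then obtain y where y: "y \<in> set (spokes m k L)" "x = w + e * zeta ^ fst y" by blast
  obtain M where M: "star (w + e * zeta ^ fst y) (e * zeta ^ opposite m (fst y)) M" using spokes_cross[OF k(2) y(1)] by blast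
  have "g dvd m" using g(1) m by (metis dvd_mult2 even_two_times_div_two dvd_triv_right dvd_trans)
  then have "g dvd opposite m (fst y)" using spokes_star(2)[OF k(2) y(1) k(1)] g(1)
    by (simp add: opposite_def dvd_mod)
  then show ?thesis using M y(2) by (auto simp: aligned_def)
qed

lemma place_add_power: "place v e (add_pos c (zeta_power s k)) = place v e c + e * zeta ^ k"
  by (simp add: place_def algebra_simps)

lemma valid_neighbours:
  assumes "valid v e l"
  shows "{x. tiling_adj T (place v e (fst l)) x} = place v e ` set (neighbour_positions m s l)"
proof -
  obtain c k L where l: "l = (c, k, L)" by (cases l) auto
  show ?thesis using spokes_neighbours[of "place v e c" e k L] assms
    by (simp add: l image_image place_add_power case_prod_beta)
qed

lemma zeta_power_eq_iff: "j < m \<Longrightarrow> k < m \<Longrightarrow> zeta ^ j = zeta ^ k \<longleftrightarrow> j = k"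
proof -
  have *: False if "j < k" "k < m" "zeta ^ j = zeta ^ k" for j k
  proof -
    have "zeta ^ k = zeta ^ j * zeta ^ (k - j)" using that(1) by (subst power_add[symmetric]) simp
    moreover have "zeta ^ j \<noteq> 0" by (simp add: zeta_def)
    ultimately have "zeta ^ (k - j) = 1" using that by simp
    moreover have "zeta ^ (k - j) = cis (2 * pi * real (k - j) / real m)"
      by (simp add: zeta_def Complex.DeMoivre mult_ac)
    moreover have "0 < k - j" "k - j < m" "2 \<le> m" using that by auto
    ultimately show False using cis_step_neq_1[of m "k - j"] by metis
  qed
  then show "j < m \<Longrightarrow> k < m \<Longrightarrow> zeta ^ j = zeta ^ k \<longleftrightarrow> j = k"
    by (metis linorder_neqE_nat)
qed

lemma spin_less: "k < m \<Longrightarrow> x \<in> set (spin m i k L) \<Longrightarrow> fst x < m"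
proof (induction i arbitrary: k L)
  case (Suc i)
  then show ?case using m(2) by (metis fst_conv mod_less_divisor set_ConsD spin.simps(2))
qed simp

text \<open>Crossing the edge yields a figure at its far end; \<open>star_unique\<close> identifies
  it with the one of the second label once both are read from the same edge. Exponents below
  \<open>m\<close> make directions comparable as numbers.\<close>

lemma fits_valid:
  assumes "valid v e l" "valid v e l'" "fst (snd l') < m" "e \<noteq> 0"
  shows "fits m s l l'"
proof -
  obtain c k L c' k' L' where l: "l = (c, k, L)" "l' = (c', k', L')" by (cases l; cases l') auto
  have k': "k' < m" using assms(3) l by simp
  have st: "star (place v e c) (e * zeta ^ k) L" "star (place v e c') (e * zeta ^ k') L'" using assms l by auto
  show ?thesis unfolding l fits.simps
  proof (intro ballI impI)
    fix x assume x: "x \<in> set (spokes m k L)" "add_pos c (zeta_power s (fst x)) = c'"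
    then have pc: "place v e c' = place v e c + e * zeta ^ fst x" using place_add_power by blast
    obtain M where M: "star (place v e c') (e * zeta ^ opposite m (fst x)) M" "matches (snd x) M"
      using spokes_cross[OF st(1) x(1)] pc by metis
    have "edge_vectors (e * zeta ^ opposite m (fst x)) M ! 0 = e * zeta ^ opposite m (fst x)" "M \<noteq> []"
      using M(1) class_nonempty[of M] by (cases M; auto simp: star_def)+
    then have "place v e c' + e * zeta ^ opposite m (fst x) \<in> {x. tiling_adj T (place v e c') x}"
      unfolding star_neighbours[OF M(1)] by (cases M) auto
    then obtain y where y: "y \<in> set (spokes m k' L')" "e * zeta ^ opposite m (fst x) = e * zeta ^ fst y"
      unfolding spokes_neighbours[OF st(2)] by auto
    have "fst y < m" using spin_less[OF k'] y(1) by (auto simp: spokes_def)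
    moreover have "opposite m (fst x) < m" using m by (simp add: opposite_def)
    ultimately have fy: "fst y = opposite m (fst x)" using y(2) assms(4) zeta_power_eq_iff by simp
    have "star (place v e c') (e * zeta ^ fst y) (snd y)" using spokes_star(1)[OF st(2) y(1)] .
    then have "snd y = M" using star_unique M(1) fy by metis
    then show "\<exists>y\<in>set (spokes m k' L'). fst y = opposite m (fst x) \<and> matches (snd x) (snd y)"
      using y(1) fy M(2) by blast
  qed
qed

lemma g_dvd_m: "g dvd m"
  using g(1) m by (metis dvd_mult2 even_two_times_div_two dvd_triv_right dvd_trans)

definition good :: "complex \<Rightarrow> complex \<Rightarrow> label \<Rightarrow> bool" where
  "good v e l \<longleftrightarrow> valid v e l \<and> fst (snd l) < m \<and> g dvd fst (snd l)"

lemma good_aligned: "good v e l \<Longrightarrow> aligned e (place v e (fst l))"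
  by (cases l) (auto simp: good_def aligned_def)

text \<open>The actual figure at the far end is among the candidates, and the filter keeps it
  because labels that hold in the tiling fit each other.\<close>

lemma branches_good:
  assumes ls: "\<forall>l\<in>set ls. good v e l" and i: "i < length ls"
    and j: "j < length (snd (snd (ls ! i)))" and e: "e \<noteq> 0"
  shows "\<exists>l\<in>set (branches m s (config_list cfg) ls i j). good v e l"
proof -
  obtain c k L where l: "ls ! i = (c, k, L)" by (cases "ls ! i") auto
  have "good v e (ls ! i)" using ls i by simp
  then have v: "star (place v e c) (e * zeta ^ k) L" and gk: "g dvd k" by (auto simp: l good_def)
  obtain k' M where kM: "spokes m k L ! j = (k', M)" by (cases "spokes m k L ! j") auto
  have x: "(k', M) \<in> set (spokes m k L)" using kM j l by (metis length_spin nth_mem snd_conv spokes_def)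
  obtain M' where M': "star (place v e c + e * zeta ^ k') (e * zeta ^ opposite m k') M'" "matches M M'" "M' \<in> config_class cfg"
    using spokes_cross[OF v x] by auto
  define b where "b = (add_pos c (zeta_power s k'), opposite m k', M')"
  have "g dvd opposite m k'"
    using spokes_star(2)[OF v x gk] g(1) g_dvd_m by (simp add: opposite_def dvd_mod)
  then have b: "valid v e b" "fst (snd b) < m" "good v e b"
    using M'(1) m by (auto simp: b_def place_add_power opposite_def good_def)
  have "b \<in> set (crossings m s (config_list cfg) (ls ! i) j)"
  proof -
    have "cfg \<noteq> []" using length_cfg by auto
    then show ?thesis using M' config_class_list[of M' cfg] by (auto simp: crossings_def l kM b_def)
  qed
  then have "b \<in> set (branches m s (config_list cfg) ls i j)"
    unfolding branches_def using fits_valid[OF _ _ _ e] b(1,2) ls unfolding good_def by simp blast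
  then show ?thesis using b by blast
qed

end

section \<open>Soundness of peeling and of the scripts\<close>

locale eigenfunction = lattice_directions +
  fixes \<gamma> :: "complex \<Rightarrow> complex \<Rightarrow> real" and f :: "complex \<Rightarrow> complex" and E :: complex
  assumes pos_weights: "\<And>v w. tiling_adj T v w \<Longrightarrow> \<gamma> v w > 0"
    and eigen: "\<And>v. v \<in> tiling_vertices T \<Longrightarrow> (\<Sum>w | tiling_adj T v w. of_real (\<gamma> v w) * f w) = E * f v"
begin

lemma last_neighbour_zero:
  assumes "star w d L" "f w = 0" "tiling_adj T w y" "\<And>x. tiling_adj T w x \<Longrightarrow> x \<noteq> y \<Longrightarrow> f x = 0"
  shows "f y = 0"
proof -
  have fin: "finite {x. tiling_adj T w x}" using star_neighbours[OF assms(1)] by simp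
  have "(\<Sum>x | tiling_adj T w x. of_real (\<gamma> w x) * f x) = (\<Sum>x\<in>{y}. of_real (\<gamma> w x) * f x)"
    by (rule sum.mono_neutral_right) (use fin assms in auto)
  moreover have "(\<Sum>x | tiling_adj T w x. of_real (\<gamma> w x) * f x) = 0"
    using eigen[of w] assms by (simp add: star_def)
  ultimately show ?thesis using pos_weights[OF assms(3)] by simp
qed

context
  fixes v e :: complex and H :: pos
  assumes e: "e \<noteq> 0" and up: "\<And>c. upward H c \<Longrightarrow> aligned e (place v e c) \<Longrightarrow> f (place v e c) = 0"
begin

lemma known_zero_sound:
  assumes "\<forall>z\<in>set Z. f (place v e z) = 0" "known_zero H Z c" "aligned e (place v e c)"
  shows "f (place v e c) = 0"
  using assms(1,2) up[OF _ assms(3)] unfolding known_zero_def by blast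

lemma peel_sound:
  assumes Z: "\<forall>z\<in>set Z. f (place v e z) = 0" and l: "good v e l"
  shows "\<forall>z\<in>set (peel m s H Z l). f (place v e z) = 0"
proof (cases "\<exists>x. known_zero H Z (fst l) \<and> filter (\<lambda>x. \<not> known_zero H Z x) (neighbour_positions m s l) = [x]")
  case True
  then obtain x where x: "known_zero H Z (fst l)"
    "filter (\<lambda>x. \<not> known_zero H Z x) (neighbour_positions m s l) = [x]" by blast
  let ?w = "place v e (fst l)"
  have al: "aligned e ?w" using good_aligned[OF l] .
  have nb: "{y. tiling_adj T ?w y} = place v e ` set (neighbour_positions m s l)"
    using valid_neighbours l by (simp add: good_def)
  have xs: "y = x" if "y \<in> set (neighbour_positions m s l)" "\<not> known_zero H Z y" for y
  proof -
    have "y \<in> set (filter (\<lambda>x. \<not> known_zero H Z x) (neighbour_positions m s l))" using that by simp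
    then show ?thesis by (simp add: x(2))
  qed
  have "x \<in> set (neighbour_positions m s l)"
    using x(2) by (metis filter_is_subset list.set_intros(1) subsetD)
  then have adj: "tiling_adj T ?w (place v e x)" using nb by blast
  obtain d L where st: "star ?w d L" using l by (cases l) (auto simp: good_def)
  have "f (place v e x) = 0"
  proof (rule last_neighbour_zero[OF st _ adj])
    show "f ?w = 0" using known_zero_sound[OF Z x(1) al] .
    fix y assume y: "tiling_adj T ?w y" "y \<noteq> place v e x"
    then obtain c where c: "c \<in> set (neighbour_positions m s l)" "y = place v e c" using nb by blast
    then have "known_zero H Z c" using xs y(2) by blast
    \<comment> \<open>Being higher gives a zero only at aligned vertices; alignment is inherited
      from \<open>?w\<close>.\<close>
    then show "f y = 0" using known_zero_sound[OF Z] aligned_neighbour[OF al y(1)] c(2) by simp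
  qed
  then show ?thesis using x Z by (simp add: peel_def)
next
  case False
  then have "peel m s H Z l = Z" by (auto simp: peel_def split: list.splits)
  then show ?thesis using Z by simp
qed

lemma check_all_branch:
  "check_all m s H cls ls bs ss \<Longrightarrow> b \<in> set bs \<Longrightarrow> \<exists>t\<in>set ss. check m s H cls (ls @ [b]) t"
proof (induction bs arbitrary: ss)
  case (Cons b' bs)
  then show ?case by (cases ss) auto
qed simp

lemma check_sound:
  "check m s H (config_list cfg) ls t \<Longrightarrow> \<forall>l\<in>set ls. good v e l \<Longrightarrow> f (place v e (0, 0, 0, 0)) = 0"
proof (induction t arbitrary: ls)
  case (Peel js)
  have "\<forall>z\<in>set (foldl (\<lambda>Z j. peel m s H Z (ls ! j)) Z js). f (place v e z) = 0"
    if "list_all (\<lambda>j. j < length ls) js" "\<forall>z\<in>set Z. f (place v e z) = 0" for Z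
    using that
  proof (induction js arbitrary: Z)
    case (Cons j js)
    have "good v e (ls ! j)" using Cons.prems(1) Peel.prems(2) by simp
    from Cons.IH[OF _ peel_sound[OF Cons.prems(2) this]] Cons.prems(1) show ?case by simp
  qed simp
  from this[of "[]"] Peel.prems(1) show ?case by (simp del: foldl.simps)
next
  case (Explore i j ss)
  then obtain b where b: "b \<in> set (branches m s (config_list cfg) ls i j)" "good v e b"
    using branches_good[OF Explore.prems(2) _ _ e, of i j] by auto
  then obtain t where "t \<in> set ss" "check m s H (config_list cfg) (ls @ [b]) t"
    using check_all_branch Explore.prems(1) by fastforce
  then show ?case using Explore.IH[of t "ls @ [b]"] Explore.prems(2) b(2) by simp
qed

end

lemma upward_height:
  assumes "upward (h0, h1, h2, h3) c" 
    "\<bar>height A B 1 - of_int h0\<bar> \<le> 1" "\<bar>height A B zeta - of_int h1\<bar> \<le> 1"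
    "\<bar>height A B (zeta ^ 2) - of_int h2\<bar> \<le> 1" "\<bar>height A B (zeta ^ 3) - of_int h3\<bar> \<le> 1"
  shows "height A B (pos_val c) > 0"
proof -
  obtain c0 c1 c2 c3 where c: "c = (c0, c1, c2, c3)" by (cases c) auto
  have err: "of_int k * x \<ge> of_int (h * k) - of_int \<bar>k\<bar>" if "\<bar>x - of_int h\<bar> \<le> 1" for x :: real and h k
  proof -
    have "\<bar>of_int k * (x - of_int h)\<bar> \<le> \<bar>of_int k\<bar> * 1"
      unfolding abs_mult using that by (intro mult_left_mono) auto
    then show ?thesis by (simp add: algebra_simps)
  qed
  have "height A B (pos_val c) = of_int c0 * height A B 1 + of_int c1 * height A B zeta
     + of_int c2 * height A B (zeta ^ 2) + of_int c3 * height A B (zeta ^ 3)"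
    by (simp add: c height_def algebra_simps)
  moreover have "real_of_int (h0 * c0 + h1 * c1 + h2 * c2 + h3 * c3) > real_of_int (\<bar>c0\<bar> + \<bar>c1\<bar> + \<bar>c2\<bar> + \<bar>c3\<bar>)"
    using assms(1) unfolding c upward.simps of_int_less_iff .
  ultimately show ?thesis
    using err[OF assms(2), of c0] err[OF assms(3), of c1] err[OF assms(4), of c2] err[OF assms(5), of c3]
    by simp
qed

lemma finite_support_zero:
  assumes fin: "finite {w \<in> tiling_vertices T. f w \<noteq> 0}"
    and H: "\<bar>height A B 1 - of_int h0\<bar> \<le> 1" "\<bar>height A B zeta - of_int h1\<bar> \<le> 1"
    "\<bar>height A B (zeta ^ 2) - of_int h2\<bar> \<le> 1" "\<bar>height A B (zeta ^ 3) - of_int h3\<bar> \<le> 1"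
    and starts: "\<And>L. L \<in> config_class cfg \<Longrightarrow> \<exists>j<length L. rotate j L \<in> set starts"
    and cert: "\<And>k L. k < m \<Longrightarrow> g dvd k \<Longrightarrow> L \<in> set starts \<Longrightarrow>
       \<exists>t. check m s (h0, h1, h2, h3) (config_list cfg) [((0, 0, 0, 0), k, L)] t"
    and v0: "v0 \<in> tiling_vertices T"
  shows "f v0 = 0"
proof (rule ccontr)
  assume f0: "f v0 \<noteq> 0"
  obtain e L0 where e: "star v0 e L0" using star_exists[OF v0] by blast
  then have e0: "e \<noteq> 0" by (simp add: star_def)
  define S where "S = {w \<in> tiling_vertices T. f w \<noteq> 0 \<and> aligned e w}"
  have "finite S" using fin by (rule finite_subset[rotated]) (auto simp: S_def)
  moreover have "v0 \<in> S"
    using v0 f0 e unfolding S_def aligned_def by (auto intro!: exI[of _ 0] exI[of _ L0])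
  \<comment> \<open>Division by \<open>e\<close> fixes the direction relative to the chosen edge, so
    that finitely many orientations remain. Ties are harmless, since \<open>upward\<close> implies
    strictly larger height.\<close>
  ultimately obtain v where v: "v \<in> S" "\<And>w. w \<in> S \<Longrightarrow> height A B (w / e) \<le> height A B (v / e)"
  proof -
    assume *: "finite S" "v0 \<in> S" and thesis: "\<And>v. v \<in> S \<Longrightarrow> (\<And>w. w \<in> S \<Longrightarrow> height A B (w / e) \<le> height A B (v / e)) \<Longrightarrow> thesis"
    then have "Max ((\<lambda>w. height A B (w / e)) ` S) \<in> (\<lambda>w. height A B (w / e)) ` S" by (intro Max_in) auto
    then obtain v where "v \<in> S" "height A B (v / e) = Max ((\<lambda>w. height A B (w / e)) ` S)" by auto
    then show thesis using thesis * by simp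
  qed
  have up: "f (place v e c) = 0" if "upward (h0, h1, h2, h3) c" "aligned e (place v e c)" for c
  proof (rule ccontr)
    assume "f (place v e c) \<noteq> 0"
    then have "place v e c \<in> S" using that(2) by (auto simp: S_def aligned_def star_def)
    moreover have "place v e c / e = v / e + pos_val c" using e0 by (simp add: place_def add_divide_distrib)
    ultimately have "height A B (v / e) + height A B (pos_val c) \<le> height A B (v / e)"
      using v(2)[of "place v e c"] by (simp add: height_def algebra_simps)
    then show False using upward_height[OF that(1) H] by simp
  qed
  obtain k L where k: "g dvd k" "star v (e * zeta ^ k) L" using v(1) by (auto simp: S_def aligned_def)
  have st: "star v (e * zeta ^ (k mod m)) L" "g dvd k mod m"
    using k g_dvd_m by (auto simp: zeta_mod dvd_mod)
  have "L \<in> config_class cfg" using k by (simp add: star_def)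
  \<comment> \<open>The figure is reread from the edge at which it begins with a starting pattern;
    only the orientation changes.\<close>
  then obtain j where j: "j < length L" "rotate j L \<in> set starts" using starts by blast
  define x where "x = spokes m (k mod m) L ! j"
  have x: "x \<in> set (spokes m (k mod m) L)" "snd x = rotate j L"
    using j by (auto simp: x_def spokes_def spin_snd)
  have "fst x < m" using spin_less[of "k mod m" x] x(1) m by (auto simp: spokes_def)
  then obtain t where t: "check m s (h0, h1, h2, h3) (config_list cfg) [((0, 0, 0, 0), fst x, snd x)] t"
    using cert[of "fst x" "snd x"] spokes_star(2)[OF st(1) x(1) st(2)] x(2) j(2) by auto
  have "place v e (0, 0, 0, 0) = v" by (simp add: place_def)
  then have "good v e ((0, 0, 0, 0), fst x, snd x)"
    using spokes_star[OF st(1) x(1)] st(2) \<open>fst x < m\<close> by (cases x) (simp add: good_def)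
  then have "f (place v e (0, 0, 0, 0)) = 0" using check_sound[OF e0 up t] by simp
  then show False using v(1) \<open>place v e (0, 0, 0, 0) = v\<close> by (simp add: S_def)
qed

end

text \<open>\<open>tab\<close> assigns to each starting pattern \<open>L\<close> the scripts for the orientations \<open>0, g, 2g, \<dots> < m\<close>.\<close>

definition certifies :: "nat \<Rightarrow> int \<Rightarrow> nat \<Rightarrow> pos \<Rightarrow> nat list \<Rightarrow> (nat list \<times> script list) list \<Rightarrow> bool" where
  "certifies m s g H cfg tab \<longleftrightarrow>
     list_all (\<lambda>L. list_ex (\<lambda>j. List.member (map fst tab) (rotate j L)) [0..<length L]) (config_list cfg) \<and>
     list_all (\<lambda>(L, ts). length ts = m div g \<and>
       list_all (\<lambda>i. check m s H (config_list cfg) [((0, 0, 0, 0), g * i, L)] (ts ! i)) [0..<m div g]) tab"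

text \<open>Heights are measured in the direction of angle 20 degrees and scaled by 1000:
  \<open>940 \<approx> 1000 cos 20\<degree>\<close> and \<open>342 \<approx> 1000 sin 20\<degree>\<close>.\<close>

lemma certifies_square:
  "certifies 12 1 3 (940, 985, 766, 342) [4,4,4,4]
    [([4,4,4,4], [Explore 0 0 [Peel [1]], Explore 0 3 [Peel [1]], Explore 0 2 [Peel [1]],
      Explore 0 1 [Peel [1]]])]"
  by code_simp

lemma certifies_triangular:
  "certifies 12 1 2 (940, 985, 766, 342) [3,3,3,3,3,3]
    [([3,3,3,3,3,3], [Explore 0 0 [Peel [1]], Explore 0 5 [Peel [1]], Explore 0 4 [Peel [1]],
      Explore 0 3 [Peel [1]], Explore 0 2 [Peel [1]], Explore 0 1 [Peel [1]]])]"
  by code_simp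

lemma certifies_hexagonal:
  "certifies 12 1 2 (940, 985, 766, 342) [6,6,6]
    [([6,6,6], [Explore 0 0 [Peel [1]], Explore 0 0 [Peel [1]], Explore 0 2 [Peel [1]],
      Explore 0 2 [Peel [1]], Explore 0 1 [Peel [1]], Explore 0 1 [Peel [1]]])]"
  by code_simp

text \<open>In a one-step script the crossed neighbour and all its other neighbours are higher than
  the origin. In orientation 2, label 2 has another lower neighbour, namely label 3, which is
  cleared by peeling at label 4. Label 3, reached through label 1, rules out a second pattern at
  label 4.\<close>

lemma certifies_elongated_triangular:
  "certifies 12 1 1 (940, 985, 766, 342) [3,3,3,4,4]
    [([3,3,3,4,4], [Explore 0 0 [Peel [1]], Explore 0 0 [Peel [1]],
      Explore 0 3 [Explore 0 4 [Explore 1 4 [Explore 2 2 [Peel [4,2]]]]],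
      Explore 0 4 [Peel [1]], Explore 0 4 [Peel [1]], Explore 0 4 [Peel [1]],
      Explore 0 3 [Peel [1]], Explore 0 3 [Peel [1]], Explore 0 2 [Peel [1], Peel [1]],
      Explore 0 2 [Peel [1], Peel [1]], Explore 0 1 [Peel [1], Peel [1]],
      Explore 0 1 [Peel [1], Peel [1]]])]"
  by code_simp

text \<open>In orientation 5 each higher neighbour of the origin has a second lower neighbour. For
  label 1 that vertex lies on a square with it, and the opposite corner of the square, label 3,
  clears it.\<close>

lemma certifies_truncated_square:
  "certifies 8 0 1 (940, 907, 342, -423) [4,8,8]
    [([4,8,8], [Explore 0 0 [Peel [1]], Explore 0 0 [Peel [1]], Explore 0 2 [Peel [1]],
      Explore 0 2 [Peel [1]], Explore 0 2 [Peel [1]],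
      Explore 0 2 [Explore 1 1 [Explore 2 2 [Peel [3,1]]]], Explore 0 1 [Peel [1]],
      Explore 0 0 [Peel [1]]])]"
  by code_simp

text \<open>Two scripts at a crossing belong to two patterns left open by the tiles at the edge. In
  orientations 2 and 7 only labels 7, 8 and 9 are peeled; the others supply edges to cross and
  constraints for \<open>fits\<close>.\<close>

lemma certifies_snub_square:
  "certifies 12 1 1 (940, 985, 766, 342) [3,3,4,3,4]
    [([3,3,4,3,4], [Explore 0 0 [Peel [1], Peel [1]], Explore 0 0 [Peel [1], Peel [1]],
      Explore 0 1 [Explore 0 2 [Explore 2 3 [Explore 2 4 [Explore 4 3
        [Explore 0 3 [Explore 0 4 [Explore 6 3 [Explore 8 2 [Peel [9,8,7]]]]]]]]]],
      Explore 0 4 [Peel [1], Peel [1]], Explore 0 4 [Peel [1], Peel [1]],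
      Explore 0 3 [Peel [1], Peel [1]], Explore 0 3 [Peel [1], Peel [1]],
      Explore 0 1 [Explore 0 0 [Explore 2 2 [Explore 2 1 [Explore 4 2
        [Explore 0 4 [Explore 0 3 [Explore 6 2 [Explore 8 3 [Peel [9,8,7]]]]]]]]]],
      Explore 0 2 [Peel [1], Peel [1]], Explore 0 2 [Peel [1], Peel [1]],
      Explore 0 1 [Peel [1]], Explore 0 1 [Peel [1]]])]"
  by code_simp

lemma certifies_rhombitrihexagonal:
  "certifies 12 1 1 (940, 985, 766, 342) [3,4,6,4]
    [([3,4,6,4], [Explore 0 0 [Peel [1]], Explore 0 0 [Peel [1]], Explore 0 3 [Peel [1]],
      Explore 0 3 [Peel [1]], Explore 0 3 [Peel [1]], Explore 0 3 [Peel [1]],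
      Explore 0 2 [Explore 1 2 [Peel [2,1]]], Explore 0 2 [Peel [1]], Explore 0 2 [Peel [1]],
      Explore 0 2 [Peel [1]], Explore 0 1 [Peel [1]], Explore 0 1 [Peel [1]]])]"
  by code_simp

text \<open>The only one of the nine vertex figures that is not a rotation of its mirror image,
  hence two starting patterns.\<close>

lemma certifies_truncated_trihexagonal:
  "certifies 12 1 1 (940, 985, 766, 342) [4,6,12]
    [([4,6,12], [Explore 0 0 [Peel [1]], Explore 0 0 [Peel [1]], Explore 0 0 [Peel [1]],
      Explore 0 2 [Explore 1 1 [Explore 2 2 [Peel [3,1]]]], Explore 0 2 [Peel [1]],
      Explore 0 2 [Peel [1]], Explore 0 2 [Peel [1]], Explore 0 2 [Peel [1]],
      Explore 0 2 [Peel [1]], Explore 0 1 [Peel [1]], Explore 0 1 [Peel [1]],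
      Explore 0 0 [Peel [1]]]), ([12,6,4], [Explore 0 0 [Peel [1]], Explore 0 0 [Peel [1]],
      Explore 0 0 [Peel [1]], Explore 0 0 [Peel [1]], Explore 0 2 [Peel [1]],
      Explore 0 2 [Peel [1]], Explore 0 1 [Peel [1]], Explore 0 1 [Peel [1]],
      Explore 0 1 [Peel [1]], Explore 0 1 [Peel [1]],
      Explore 0 1 [Explore 1 2 [Explore 2 1 [Peel [3,1]]]],
      Explore 0 0 [Explore 1 1 [Explore 2 2 [Explore 3 2 [Explore 4 1 [Peel [5,3,1]]]]]]])]"
  by code_simp

text \<open>The two mirror images of this tiling have the same vertex figure; the candidates cover
  both, with up to three patterns at a crossing.\<close>

lemma certifies_snub_hexagonal:
  "certifies 12 1 2 (940, 985, 766, 342) [3,3,3,3,6]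
    [([3,3,3,3,6], [Explore 0 0 [Peel [1]],
      Explore 0 0 [Explore 0 1 [Explore 2 3 [Explore 1 3 [Explore 3 4
        [Explore 3 2 [Explore 3 3 [Explore 6 3 [Peel [8,6,4,1]]]]]]],
      Explore 1 3 [Peel [3,1]]]], Explore 0 4 [Peel [1]],
      Explore 0 3 [Peel [1], Peel [1], Peel [1]], Explore 0 2 [Peel [1], Peel [1], Peel [1]],
      Explore 0 1 [Peel [1], Peel [1], Peel [1]]])]"
  by code_simp

section \<open>Absence of flat bands\<close>

lemma cos_sin_30_60: "cos (pi / 6) = sqrt 3 / 2" "sin (pi / 6) = 1 / 2" "cos (pi / 3) = 1 / 2" "sin (pi / 3) = sqrt 3 / 2"
  by (simp_all add: cos_30 sin_30 cos_60 sin_60)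

lemma sqrt_bounds: "1.732 < sqrt 3" "sqrt 3 < 1.7321" "1.4142 < sqrt 2" "sqrt 2 < 1.4143"
  by (rule real_less_rsqrt real_less_lsqrt; simp add: power2_eq_square)+

lemma zeta_powers_12:
  defines "z \<equiv> cis (2 * pi / real 12)"
  shows "z = Complex (sqrt 3 / 2) (1 / 2)" "z ^ 2 = Complex (1 / 2) (sqrt 3 / 2)" "z ^ 3 = \<i>" "z ^ 4 = z ^ 2 - 1"
proof -
  have z: "z = cis (pi / 6)" by (simp add: z_def)
  show 1: "z = Complex (sqrt 3 / 2) (1 / 2)" by (simp add: z cos_sin_30_60 complex_eq_iff)
  show 2: "z ^ 2 = Complex (1 / 2) (sqrt 3 / 2)" 
    by (simp add: 1 power2_eq_square complex_eq_iff)
  show 3: "z ^ 3 = \<i>" by (simp add: z Complex.DeMoivre)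
  have "z ^ 4 = z * z ^ 3" by (simp add: numeral_eq_Suc)
  also have "\<dots> = z ^ 2 - 1" unfolding 2 3 by (simp add: 1 complex_eq_iff)
  finally show "z ^ 4 = z ^ 2 - 1" .
qed

lemma zeta_powers_8:
  defines "z \<equiv> cis (2 * pi / real 8)"
  shows "z = Complex (sqrt 2 / 2) (sqrt 2 / 2)" "z ^ 2 = \<i>" "z ^ 3 = Complex (- sqrt 2 / 2) (sqrt 2 / 2)" "z ^ 4 = - 1"
proof -
  have z: "z = cis (pi / 4)" by (simp add: z_def)
  show 1: "z = Complex (sqrt 2 / 2) (sqrt 2 / 2)" by (simp add: z cos_45 sin_45 complex_eq_iff)
  show 2: "z ^ 2 = \<i>" by (simp add: z Complex.DeMoivre)
  have "z ^ 3 = z * z ^ 2" by (simp add: numeral_eq_Suc)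
  then show "z ^ 3 = Complex (- sqrt 2 / 2) (sqrt 2 / 2)" unfolding 2 by (simp add: 1 complex_eq_iff)
  have "z ^ 4 = (z ^ 2) ^ 2" by simp
  then show "z ^ 4 = - 1" unfolding 2 by simp
qed

context lattice_tiling
begin

lemma no_flat_band_from_certificate:
  fixes \<gamma> :: "complex \<Rightarrow> complex \<Rightarrow> real" and E :: complex
  assumes cert: "certifies m s g (h0, h1, h2, h3) cfg tab"
    and loc: "lattice_directions T cfg m g s"
    and H: "\<bar>height A B 1 - of_int h0\<bar> \<le> 1" "\<bar>height A B (cis (2 * pi / real m)) - of_int h1\<bar> \<le> 1"
    "\<bar>height A B (cis (2 * pi / real m) ^ 2) - of_int h2\<bar> \<le> 1" "\<bar>height A B (cis (2 * pi / real m) ^ 3) - of_int h3\<bar> \<le> 1"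
    and weights: "\<And>v w. tiling_adj T v w \<Longrightarrow> \<gamma> v w > 0"
  shows "\<not> flat_eigenvalue T b1 b2 \<gamma> E"
proof
  assume "flat_eigenvalue T b1 b2 \<gamma> E"
  then obtain h where h: "finite {v \<in> tiling_vertices T. h v \<noteq> 0}" "\<exists>v\<in>tiling_vertices T. h v \<noteq> 0"
    "\<And>v. v \<in> tiling_vertices T \<Longrightarrow> (\<Sum>w | tiling_adj T v w. of_real (\<gamma> v w) * h w) = E * h v"
    using finite_support_eigenfunction by blast
  interpret lattice_directions T cfg m g s by (rule loc)
  interpret eigenfunction T cfg m g s \<gamma> h E
    by unfold_locales (use weights h(3) in auto)
  have "h v = 0" if "v \<in> tiling_vertices T" for v
  proof (rule finite_support_zero[OF h(1) H(1) _ _ _ _ _ that, unfolded zeta_def])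
    fix L assume "L \<in> config_class cfg"
    moreover have "cfg \<noteq> []" using length_cfg by auto
    ultimately show "\<exists>j<length L. rotate j L \<in> set (map fst tab)"
      using cert config_class_list by (fastforce simp: certifies_def list_all_iff list_ex_iff)
  next
    fix k L assume k: "k < m" "g dvd k" and L: "L \<in> set (map fst tab)"
    from L obtain ts where ts: "(L, ts) \<in> set tab" by auto
    obtain i where i: "k = g * i" using k(2) by blast
    have "m = g * (m div g)" using g_dvd_m by simp
    then have "i < m div g" using k(1) i by (metis mult_less_cancel1)
    then have "check m s (h0, h1, h2, h3) (config_list cfg) [((0, 0, 0, 0), g * i, L)] (ts ! i)"
      using cert ts by (fastforce simp: certifies_def list_all_iff)
    then show "\<exists>t. check m s (h0, h1, h2, h3) (config_list cfg) [((0, 0, 0, 0), k, L)] t"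
      using i by blast
  qed (use H in auto)
  then show False using h(2) by blast
qed

lemma no_flat_band_12:
  fixes \<gamma> :: "complex \<Rightarrow> complex \<Rightarrow> real" and E :: complex
  assumes cert: "certifies 12 1 g (940, 985, 766, 342) cfg tab"
    and g: "g dvd 6" "\<And>n. n \<in> set cfg \<Longrightarrow> g dvd angle_units 12 n"
    and units: "\<And>n. n \<in> set cfg \<Longrightarrow> n \<in> {3, 4, 6, 12}"
    and weights: "\<And>v w. tiling_adj T v w \<Longrightarrow> \<gamma> v w > 0"
  shows "\<not> flat_eigenvalue T b1 b2 \<gamma> E"
proof (rule no_flat_band_from_certificate[OF cert _ _ _ _ _ weights])
  show "lattice_directions T cfg 12 g 1"
  proof unfold_locales
    fix n assume "n \<in> set cfg"
    from units[OF this] show "interior_angle n = 2 * pi * real (angle_units 12 n) / real 12"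
      by (auto simp: interior_angle_def angle_units_def)
  qed (use g zeta_powers_12(4) in auto)
  show "\<bar>height 940 342 1 - real_of_int 940\<bar> \<le> 1"
    "\<bar>height 940 342 (cis (2 * pi / real 12)) - real_of_int 985\<bar> \<le> 1"
    "\<bar>height 940 342 (cis (2 * pi / real 12) ^ 2) - real_of_int 766\<bar> \<le> 1"
    "\<bar>height 940 342 (cis (2 * pi / real 12) ^ 3) - real_of_int 342\<bar> \<le> 1"
    unfolding zeta_powers_12(2,3) unfolding zeta_powers_12(1) using sqrt_bounds by (auto simp: height_def abs_le_iff)
qed

lemma no_flat_band_8:
  fixes \<gamma> :: "complex \<Rightarrow> complex \<Rightarrow> real" and E :: complex
  assumes cert: "certifies 8 0 1 (940, 907, 342, -423) cfg tab"
    and units: "\<And>n. n \<in> set cfg \<Longrightarrow> n \<in> {4, 8}"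
    and weights: "\<And>v w. tiling_adj T v w \<Longrightarrow> \<gamma> v w > 0"
  shows "\<not> flat_eigenvalue T b1 b2 \<gamma> E"
proof (rule no_flat_band_from_certificate[OF cert _ _ _ _ _ weights])
  show "lattice_directions T cfg 8 1 0"
  proof unfold_locales
    fix n assume "n \<in> set cfg"
    from units[OF this] show "interior_angle n = 2 * pi * real (angle_units 8 n) / real 8"
      by (auto simp: interior_angle_def angle_units_def)
  qed (use zeta_powers_8(4) in auto)
  show "\<bar>height 940 342 1 - real_of_int 940\<bar> \<le> 1"
    "\<bar>height 940 342 (cis (2 * pi / real 8)) - real_of_int 907\<bar> \<le> 1"
    "\<bar>height 940 342 (cis (2 * pi / real 8) ^ 2) - real_of_int 342\<bar> \<le> 1"
    "\<bar>height 940 342 (cis (2 * pi / real 8) ^ 3) - real_of_int (-423)\<bar> \<le> 1"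
    unfolding zeta_powers_8(2,3) unfolding zeta_powers_8(1) using sqrt_bounds by (auto simp: height_def abs_le_iff)
qed

end

section \<open>The nine tilings and the two operators\<close>

definition admissible_configs :: "nat list set" where
  "admissible_configs = {[4,4,4,4], [3,3,3,3,3,3], [6,6,6], [3,3,3,4,4], [4,8,8],
                   [3,3,4,3,4], [3,4,6,4], [4,6,12], [3,3,3,3,6]}"

lemma admissible_lattice_tiling:
  assumes "cfg \<in> admissible_configs" "archimedean_tiling cfg T" "lattice_basis T b1 b2"
  shows "lattice_tiling T cfg b1 b2"
proof unfold_locales
  show "total_angle cfg = 2 * pi" "length cfg \<ge> 3" "\<And>n. n \<in> set cfg \<Longrightarrow> n \<ge> 3"
    using assms(1) by (auto simp: admissible_configs_def interior_angle_def)
qed (use assms in auto)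

lemma no_flat_eigenvalue:
  fixes \<gamma> :: "complex \<Rightarrow> complex \<Rightarrow> real" and E :: complex
  assumes cfg: "cfg \<in> admissible_configs" and T: "archimedean_tiling cfg T" "lattice_basis T b1 b2"
    and weights: "\<And>v w. tiling_adj T v w \<Longrightarrow> \<gamma> v w > 0"
  shows "\<not> flat_eigenvalue T b1 b2 \<gamma> E"
proof -
  interpret lattice_tiling T cfg b1 b2 using admissible_lattice_tiling[OF cfg T] .
  from cfg consider "cfg = [4,4,4,4]" | "cfg = [3,3,3,3,3,3]" | "cfg = [6,6,6]" | "cfg = [3,3,3,4,4]" | "cfg = [4,8,8]"
    | "cfg = [3,3,4,3,4]" | "cfg = [3,4,6,4]" | "cfg = [4,6,12]" | "cfg = [3,3,3,3,6]"
    unfolding admissible_configs_def insert_iff empty_iff by (elim disjE FalseE)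
  then show ?thesis
  proof cases
    case 1 show ?thesis by (rule no_flat_band_12[OF certifies_square[folded 1] _ _ _ weights]) (auto simp: 1 angle_units_def)
  next
    case 2 show ?thesis by (rule no_flat_band_12[OF certifies_triangular[folded 2] _ _ _ weights]) (auto simp: 2 angle_units_def)
  next
    case 3 show ?thesis by (rule no_flat_band_12[OF certifies_hexagonal[folded 3] _ _ _ weights]) (auto simp: 3 angle_units_def)
  next
    case 4 show ?thesis by (rule no_flat_band_12[OF certifies_elongated_triangular[folded 4] _ _ _ weights]) (auto simp: 4 angle_units_def)
  next
    case 5 show ?thesis by (rule no_flat_band_8[OF certifies_truncated_square[folded 5] _ weights]) (auto simp: 5)
  next
    case 6 show ?thesis by (rule no_flat_band_12[OF certifies_snub_square[folded 6] _ _ _ weights]) (auto simp: 6 angle_units_def)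
  next
    case 7 show ?thesis by (rule no_flat_band_12[OF certifies_rhombitrihexagonal[folded 7] _ _ _ weights]) (auto simp: 7 angle_units_def)
  next
    case 8 show ?thesis by (rule no_flat_band_12[OF certifies_truncated_trihexagonal[folded 8] _ _ _ weights]) (auto simp: 8 angle_units_def)
  next
    case 9 show ?thesis by (rule no_flat_band_12[OF certifies_snub_hexagonal[folded 9] _ _ _ weights]) (auto simp: 9 angle_units_def)
  qed
qed

text \<open>\<open>matrix_op\<close> sums over the nonzero entries, and positivity of the weights
  makes these exactly the neighbours.\<close>

lemma (in lattice_tiling) flat_band_adjacency:
  assumes "edge_weights T \<gamma>" "has_flat_band T b1 b2 (matrix_op T (weighted_adjacency T \<gamma>))"
  obtains E where "flat_eigenvalue T b1 b2 \<gamma> (of_real E)"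
proof -
  have pos: "tiling_adj T v w \<Longrightarrow> \<gamma> v w > 0" for v w using assms(1) by (auto simp: edge_weights_def)
  have "matrix_op T (weighted_adjacency T \<gamma>) f v = (\<Sum>w | tiling_adj T v w. of_real (\<gamma> v w) * f w)" for f v
  proof -
    have "{w. w \<in> tiling_vertices T \<and> weighted_adjacency T \<gamma> v w \<noteq> 0} = {w. tiling_adj T v w}"
    proof -
      have "weighted_adjacency T \<gamma> v w \<noteq> 0 \<longleftrightarrow> tiling_adj T v w" for w
        using pos[of v w] by (auto simp: weighted_adjacency_def)
      then show ?thesis using adjacent_is_vertex by auto
    qed
    then show ?thesis by (auto simp: matrix_op_def weighted_adjacency_def intro!: sum.cong)
  qed
  then show thesis using assms(2) that by (auto simp: has_flat_band_def flat_band_at_def flat_eigenvalue_def)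
qed

lemma vertex_weight_monomeric:
  assumes "monomeric_weights T \<gamma>"
  obtains \<mu> where "\<And>v. v \<in> tiling_vertices T \<Longrightarrow> vertex_weight T \<gamma> v = \<mu>"
proof -
  from assms obtain L where L: "\<And>v. v \<in> tiling_vertices T \<Longrightarrow>
      \<exists>ws k. ccw_neighbours T v ws \<and> map (\<gamma> v) ws = rotate k L"
    by (auto simp: monomeric_weights_def)
  have "vertex_weight T \<gamma> v = sum_list L" if v: "v \<in> tiling_vertices T" for v
  proof -
    obtain ws k where ws: "ccw_neighbours T v ws" "map (\<gamma> v) ws = rotate k L" using L[OF v] by blast
    have "sorted_wrt (\<lambda>x y. Arg2pi (x - v) < Arg2pi (y - v)) ws" using ws(1) by (simp add: ccw_neighbours_def)
    then have "distinct ws" by (induction ws) auto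
    then have "vertex_weight T \<gamma> v = sum_list (map (\<gamma> v) ws)"
      using ws(1) by (simp add: vertex_weight_def ccw_neighbours_def sum_list_distinct_conv_sum_set)
    also have "\<dots> = sum_list (rotate k L)" by (simp add: ws(2))
    also have "\<dots> = sum_list L"
    proof (induction k)
      case (Suc k)
      have "sum_list (rotate1 xs) = sum_list xs" for xs :: "real list" by (cases xs) auto
      then show ?case using Suc by simp
    qed simp
    finally show ?thesis .
  qed
  then show thesis by (rule that)
qed

lemma vertex_weight_constant:
  assumes "archimedean T cfg" "constant_weights T \<gamma>"
  obtains \<mu> where "\<And>v. v \<in> tiling_vertices T \<Longrightarrow> vertex_weight T \<gamma> v = \<mu>"
proof -
  interpret archimedean T cfg by fact
  from assms(2) obtain c where c: "\<And>v w. tiling_adj T v w \<Longrightarrow> \<gamma> v w = c" by (auto simp: constant_weights_def)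
  have "vertex_weight T \<gamma> v = real (length cfg) * c" if v: "v \<in> tiling_vertices T" for v
  proof -
    obtain d L where st: "star v d L" using star_exists[OF v] by blast
    have "card {w. tiling_adj T v w} = card (set (edge_vectors d L))"
      unfolding star_neighbours[OF st] by (rule card_image) simp
    also have "\<dots> = length cfg"
      using edge_vectors_distinct[OF st] config_class_length st by (simp add: distinct_card star_def)
    finally show ?thesis using c by (simp add: vertex_weight_def)
  qed
  then show thesis by (rule that)
qed

text \<open>The Laplacian is the identity minus the adjacency operator divided by \<mu>, so energy
  \<open>E\<close> corresponds to \<open>\<mu> * (1 - E)\<close>.\<close>

lemma flat_band_laplacian:
  assumes flat: "has_flat_band T b1 b2 (laplacian T \<gamma>)"
    and \<mu>: "\<And>v. v \<in> tiling_vertices T \<Longrightarrow> vertex_weight T \<gamma> v = \<mu>" "\<mu> \<noteq> 0"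
  obtains E :: real where "flat_eigenvalue T b1 b2 \<gamma> (of_real E)"
proof -
  from flat obtain E where E: "\<And>\<theta>. \<exists>f\<in>bloch_space T b1 b2 \<theta>. (\<exists>v\<in>tiling_vertices T. f v \<noteq> 0) \<and>
        (\<forall>v\<in>tiling_vertices T. laplacian T \<gamma> f v = of_real E * f v)"
    by (auto simp: has_flat_band_def flat_band_at_def)
  have "(\<Sum>w | tiling_adj T v w. of_real (\<gamma> v w) * f w) = of_real (\<mu> * (1 - E)) * f v"
    if "v \<in> tiling_vertices T" "laplacian T \<gamma> f v = of_real E * f v" for f v
  proof -
    have "f v - (\<Sum>w | tiling_adj T v w. of_real (\<gamma> v w) * f w) / of_real \<mu> = of_real E * f v"
      using that \<mu>(1)[OF that(1)] by (simp add: laplacian_def)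
    then have "(\<Sum>w | tiling_adj T v w. of_real (\<gamma> v w) * f w) / of_real \<mu> = (1 - of_real E) * f v"
      by (simp add: algebra_simps)
    then show ?thesis using \<mu>(2) by (simp add: divide_eq_eq mult_ac)
  qed
  then show thesis using E unfolding flat_eigenvalue_def by (intro that[of "\<mu> * (1 - E)"]) (unfold flat_eigenvalue_def, blast)
qed

theorem proposition5:
  fixes T :: "complex set set" and cfg :: "nat list" and b1 b2 :: complex
  assumes "cfg \<in> {[4,4,4,4], [3,3,3,3,3,3], [6,6,6], [3,3,3,4,4], [4,8,8],
                   [3,3,4,3,4], [3,4,6,4], [4,6,12], [3,3,3,3,6]}"
    and "archimedean_tiling cfg T"
    and "lattice_basis T b1 b2"
  shows "(\<nexists>\<gamma>. edge_weights T \<gamma> \<and> periodic_weights T b1 b2 \<gamma> \<and>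
              has_flat_band T b1 b2 (matrix_op T (weighted_adjacency T \<gamma>))) \<and>
         (\<forall>\<gamma>. edge_weights T \<gamma> \<and>
              (constant_weights T \<gamma> \<or> periodic_weights T b1 b2 \<gamma> \<and> monomeric_weights T \<gamma>) \<longrightarrow>
              \<not> has_flat_band T b1 b2 (laplacian T \<gamma>))"
proof -
  have adm: "cfg \<in> admissible_configs" using assms(1) by (simp add: admissible_configs_def)
  interpret lattice_tiling T cfg b1 b2 using admissible_lattice_tiling[OF adm assms(2,3)] .
  have none: "\<not> flat_eigenvalue T b1 b2 \<gamma> (of_real E)"
    if "edge_weights T \<gamma>" for \<gamma> and E :: real
    by (rule no_flat_eigenvalue[OF adm assms(2,3)]) (use that in \<open>simp add: edge_weights_def\<close>)
  have "\<not> has_flat_band T b1 b2 (matrix_op T (weighted_adjacency T \<gamma>))"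
    if \<gamma>: "edge_weights T \<gamma>" for \<gamma>
  proof
    assume "has_flat_band T b1 b2 (matrix_op T (weighted_adjacency T \<gamma>))"
    then obtain E :: real where "flat_eigenvalue T b1 b2 \<gamma> (of_real E)"
      using flat_band_adjacency[OF \<gamma>] by blast
    then show False using none[OF \<gamma>] by blast
  qed
  moreover have "\<not> has_flat_band T b1 b2 (laplacian T \<gamma>)"
    if \<gamma>: "edge_weights T \<gamma>" "constant_weights T \<gamma> \<or> monomeric_weights T \<gamma>" for \<gamma>
  proof
    assume flat: "has_flat_band T b1 b2 (laplacian T \<gamma>)"
    obtain \<mu> where \<mu>: "\<And>v. v \<in> tiling_vertices T \<Longrightarrow> vertex_weight T \<gamma> v = \<mu>"
      using \<gamma>(2) vertex_weight_constant[OF archimedean_axioms] vertex_weight_monomeric by metis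
    have "\<mu> \<noteq> 0" using vertex_exists vertex_weight_pos[OF \<gamma>(1)] \<mu> by (metis less_irrefl)
    then show False using flat_band_laplacian[OF flat \<mu>] none[OF \<gamma>(1)] by blast
  qed
  ultimately show ?thesis by blast
qed

end
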